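(* Let $\beta<\eta<\alpha$ and assume $$K\,\mathrm{Lip}_uG\,\Big(\frac{1}{\eta-\beta}+\frac{1}{\alpha-\eta}\Big)<1.$$ Let $M^s(\omega)=\{u_0\in H\;|\;u(\cdot,\omega,u_0)\in C_\eta^+\}$. Then $$\tilde M^s(\omega)=T^{-1}(\omega,M^s(\omega)),\qquad \omega\in\Omega,$$ is a Lipschitz stable manifold of the stochastic partial differential equation $$du=Au\,dt+F(u)\,dt+\frac u2\,dt+u\,dW,$$ i.e. of the random dynamical system $\hat u$ generated by it.
   Context: **State space and linear part.** $H$ is an infinite dimensional separable Hilbert space with norm $|\cdot|$. The linear operator $A:D(A)\to H$ generates a strongly continuous semigroup $e^{At}$ on $H$ satisfying an exponential dichotomy with exponents $\alpha>\beta$ and bound $K$: there is a continuous projection $P^+$ on $H$ such that (i) $P^+e^{At}=e^{At}P^+$; (ii) for $t\ge 0$ the restriction $e^{At}|_{R(P^+)}$ is an isomorphism of the range $R(P^+)$ onto itself, and $e^{At}$ for $t<0$ is defined on $R(P^+)$ as the inverse map; (iii) $|e^{At}P^+x|\le Ke^{\alpha t}|x|$ for $t\le 0$ and $|e^{At}P^-x|\le Ke^{\beta t}|x|$ for $t\ge 0$, where $P^-=I-P^+$. Put $H^-=P^-H$ (stable subspace), $H^+=P^+H$ (unstable subspace), so $H=H^+\oplus H^-$. **Nonlinearity.** $F:H\to H$ satisfies $F(0)=0$ and $|P^\pm(F(x_1)-F(x_2))|\le \mathrm{Lip}F\,|x_1-x_2|$ for all $x_1,x_2\in H$, with Lipschitz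 constant $\mathrm{Lip}F>0$. **Noise.** Let $C_0(\mathbb R,\mathbb R)$ be the continuous functions $\omega:\mathbb R\to\mathbb R$ with $\omega(0)=0$, with the compact open topology, its Borel $\sigma$-algebra and the (two-sided) Wiener measure $\mathbb P$, and let $\theta_t\omega=\omega(\cdot+t)-\omega(t)$. $\Omega\subset C_0(\mathbb R,\mathbb R)$ is a Borel set of $\mathbb P$-measure one with $\theta_t\Omega=\Omega$ for all $t\in\mathbb R$, such that for $\omega\in\Omega$: $\omega(t)/t\to0$ as $t\to\pm\infty$; $z(\omega)=-\int_{-\infty}^0e^\tau\omega(\tau)\,d\tau$ exists; $t\mapsto z(\theta_t\omega)$ is continuous (it is the stationary solution of $dz+z\,dt=dW$, $W(t)=\omega(t)$); and $|z(\theta_t\omega)|/|t|\to0$, $\frac1t\int_0^tz(\theta_\tau\omega)\,d\tau\to0$ as $t\to\pm\infty$. $\mathcal F$ is the trace on $\Omega$ of the Borel $\sigma$-algebra, and $\mathbb P$ is restricted to $\mathcal F$. **Random PDE.** $G(\omega,u)=e^{-z(\omega)}F(e^{z(\omega)}u)$. For every $\omega$, $G(\omega,\cdot)$ satisfies the same Lipschitz estimate as $F$, and $\mathrm{Lip}_uG$ $(=\mathrm{Lip}F)$ denotes the Lipschitz constant of $G$ with respect to $u$: $|P^\pm(G(\omega,x_1)-G(\omega,x_2))|\le\mathrm{Lip}_uG\,|x_1-x_2|$. For each $\omega\in\Omega$ and $u_0\in H$, $u(t,\omega,u_0)$, $t\ge0$, is the unique mild solution of $\frac{du}{dt}=Au+z(\theta_t\omega)u+G(\theta_t\omega,u)$,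 $u(0)=u_0$, i.e. $$u(t)=e^{At+\int_0^tz(\theta_\tau\omega)d\tau}u_0+\int_0^te^{A(t-s)+\int_s^tz(\theta_r\omega)dr}G(\theta_s\omega,u(s))\,ds.$$ The map $(t,\omega,x)\mapsto u(t,\omega,x)$ is a random dynamical system on $H$ over $\theta$ (measurable, $u(0,\omega,x)=x$, $u(t_1+t_2,\omega,x)=u(t_2,\theta_{t_1}\omega,u(t_1,\omega,x))$). **Stochastic PDE.** The stochastic equation (Ito form; in Stratonovich form $\frac{du}{dt}=Au+F(u)+u\,\dot W$, $W$ the standard real Wiener process $W(t)=\omega(t)$) generates the random dynamical system $$\hat u(t,\omega,x)=T^{-1}(\theta_t\omega,u(t,\omega,T(\omega,x))),\qquad T(\omega,x)=xe^{-z(\omega)},\quad T^{-1}(\omega,x)=xe^{z(\omega)}.$$ **Function space.** For $\beta<\eta<\alpha$ (and given $\omega$), $C_\eta^+$ is the Banach space of continuous $\phi:[0,\infty)\to H$ with $|\phi|_{C_\eta^+}=\sup_{t\ge0}e^{-\eta t-\int_0^tz(\theta_\tau\omega)d\tau}|\phi(t)|<\infty$. **Invariant manifolds.** A random set is a family $M=\{M(\omega)\}_{\omega\in\Omega}$ of nonempty closed subsets of $H$ such that $\omega\mapsto\inf_{y\in M(\omega)}|x-y|$ is a random variable for every $x\in H$. It is invariant for a random dynamical system $\phi$ if $\phi(t,\omega,M(\omega))\subset M(\theta_t\omega)$ for all $t\ge0$. An invariant random set of the form $M(\omega)=\{\xi+h(\xi,\omega)\,|\,\xi\in H^-\}$ with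 $h(\cdot,\omega):H^-\to H^+$ Lipschitz is called a Lipschitz stable manifold. *)

theory Defs
  imports "HOL-Probability.Probability"
begin

section \<open>Semigroups and exponential dichotomies\<close>

text \<open>Only the values \<open>S t\<close> with \<open>t \<ge> 0\<close> are meaningful.\<close>

definition C0_semigroup :: "(real \<Rightarrow> 'h::real_normed_vector \<Rightarrow>\<^sub>L 'h) \<Rightarrow> bool" where
  "C0_semigroup S \<longleftrightarrow>
     S 0 = id_blinfun \<and>
     (\<forall>s\<ge>0. \<forall>t\<ge>0. S (s + t) = S s o\<^sub>L S t) \<and>
     (\<forall>x. continuous_on {0..} (\<lambda>t. S t x))"

definition generates_C0_semigroup ::
    "'h::real_normed_vector set \<Rightarrow> ('h \<Rightarrow> 'h) \<Rightarrow> (real \<Rightarrow> 'h \<Rightarrow>\<^sub>L 'h) \<Rightarrow> bool" where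
  "generates_C0_semigroup D A S \<longleftrightarrow>
     C0_semigroup S \<and>
     D = {x. \<exists>y. ((\<lambda>h. (S h x - x) /\<^sub>R h) \<longlongrightarrow> y) (at_right 0)} \<and>
     (\<forall>x\<in>D. ((\<lambda>h. (S h x - x) /\<^sub>R h) \<longlongrightarrow> A x) (at_right 0))"

definition compl_proj :: "('h::real_normed_vector \<Rightarrow>\<^sub>L 'h) \<Rightarrow> 'h \<Rightarrow>\<^sub>L 'h" where
  "compl_proj P = id_blinfun - P"

text \<open>The extension of \<open>S\<close> to negative times on \<open>range P\<close>.\<close>

definition two_sided ::
    "(real \<Rightarrow> 'h::real_normed_vector \<Rightarrow>\<^sub>L 'h) \<Rightarrow> ('h \<Rightarrow>\<^sub>L 'h) \<Rightarrow> real \<Rightarrow> 'h \<Rightarrow> 'h" where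
  "two_sided S P t x = (if 0 \<le> t then S t x else inv_into (range P) (S (- t)) x)"

definition exponential_dichotomy ::
    "(real \<Rightarrow> 'h::real_normed_vector \<Rightarrow>\<^sub>L 'h) \<Rightarrow> ('h \<Rightarrow>\<^sub>L 'h) \<Rightarrow> real \<Rightarrow> real \<Rightarrow> real \<Rightarrow> bool" where
  "exponential_dichotomy S P \<alpha> \<beta> K \<longleftrightarrow>
     \<beta> < \<alpha> \<and>
     P o\<^sub>L P = P \<and>
     (\<forall>t\<ge>0. P o\<^sub>L S t = S t o\<^sub>L P) \<and>
     (\<forall>t\<ge>0. homeomorphism (range P) (range P) (S t) (inv_into (range P) (S t))) \<and>
     (\<forall>t\<le>0. \<forall>x. norm (two_sided S P t (P x)) \<le> K * exp (\<alpha> * t) * norm x) \<and>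
     (\<forall>t\<ge>0. \<forall>x. norm (S t (compl_proj P x)) \<le> K * exp (\<beta> * t) * norm x)"

definition proj_lipschitz ::
    "('h::real_normed_vector \<Rightarrow>\<^sub>L 'h) \<Rightarrow> real \<Rightarrow> ('h \<Rightarrow> 'h) \<Rightarrow> bool" where
  "proj_lipschitz P L f \<longleftrightarrow>
     (\<forall>x y. norm (P (f x - f y)) \<le> L * norm (x - y) \<and>
            norm (compl_proj P (f x - f y)) \<le> L * norm (x - y))"

section \<open>The Wiener space\<close>

definition C0_paths :: "(real \<Rightarrow> real) set" where
  "C0_paths = {\<omega>. continuous_on UNIV \<omega> \<and> \<omega> 0 = 0}"

definition compact_open_topology :: "(real \<Rightarrow> real) topology" where
  "compact_open_topology =
     topology_generated_by {{\<omega> \<in> C0_paths. \<omega> ` C \<subseteq> U} | C U. compact C \<and> open U}"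

definition borel_C0 :: "(real \<Rightarrow> real) measure" where
  "borel_C0 = sigma C0_paths {U. openin compact_open_topology U}"

text \<open>The two-sided Wiener measure is the law of a process that starts in 0 (which is built into
  \<^const>\<open>C0_paths\<close>), is indexed by the whole real line, and has independent increments
  \<open>\<omega> t - \<omega> s\<close> distributed as \<open>N(0, t - s)\<close>; \<^const>\<open>normal_density\<close> takes the standard deviation.\<close>

definition wiener_measure :: "(real \<Rightarrow> real) measure \<Rightarrow> bool" where
  "wiener_measure W \<longleftrightarrow>
     prob_space W \<and>
     sets W = sets borel_C0 \<and>
     (\<forall>s t. s < t \<longrightarrow>
        distributed W lborel (\<lambda>\<omega>. \<omega> t - \<omega> s) (\<lambda>x. ennreal (normal_density 0 (sqrt (t - s)) x))) \<and>
     (\<forall>(\<tau> :: nat \<Rightarrow> real) n. strict_mono_on {..n} \<tau> \<longrightarrow>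
        prob_space.indep_vars W (\<lambda>_. borel) (\<lambda>i \<omega>. \<omega> (\<tau> (Suc i)) - \<omega> (\<tau> i)) {..<n})"

definition wiener_shift :: "real \<Rightarrow> (real \<Rightarrow> real) \<Rightarrow> real \<Rightarrow> real" where
  "wiener_shift t \<omega> = (\<lambda>s. \<omega> (s + t) - \<omega> t)"

definition zOU :: "(real \<Rightarrow> real) \<Rightarrow> real" where
  "zOU \<omega> = - (LBINT \<tau>:{..0}. exp \<tau> * \<omega> \<tau>)"

text \<open>The integral is oriented, so it changes sign when \<open>t < s\<close>.\<close>

definition zOU_int :: "(real \<Rightarrow> real) \<Rightarrow> real \<Rightarrow> real \<Rightarrow> real" where
  "zOU_int \<omega> s t = (LBINT \<tau>=ereal s..ereal t. zOU (wiener_shift \<tau> \<omega>))"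

text \<open>On the real line \<^term>\<open>at_infinity\<close> covers both \<open>t \<rightarrow> \<infinity>\<close> and \<open>t \<rightarrow> -\<infinity>\<close>.\<close>

definition noise_set :: "(real \<Rightarrow> real) measure \<Rightarrow> (real \<Rightarrow> real) set \<Rightarrow> bool" where
  "noise_set W \<Omega> \<longleftrightarrow>
     \<Omega> \<in> sets W \<and> emeasure W \<Omega> = 1 \<and>
     (\<forall>t. wiener_shift t ` \<Omega> = \<Omega>) \<and>
     (\<forall>\<omega>\<in>\<Omega>.
        ((\<lambda>t. \<omega> t / t) \<longlongrightarrow> 0) at_infinity \<and>
        set_integrable lborel {..0} (\<lambda>\<tau>. exp \<tau> * \<omega> \<tau>) \<and>
        continuous_on UNIV (\<lambda>t. zOU (wiener_shift t \<omega>)) \<and>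
        ((\<lambda>t. \<bar>zOU (wiener_shift t \<omega>)\<bar> / \<bar>t\<bar>) \<longlongrightarrow> 0) at_infinity \<and>
        ((\<lambda>t. (1 / t) * zOU_int \<omega> 0 t) \<longlongrightarrow> 0) at_infinity)"

section \<open>The random and the stochastic equation\<close>

definition G_of :: "('h::real_vector \<Rightarrow> 'h) \<Rightarrow> (real \<Rightarrow> real) \<Rightarrow> 'h \<Rightarrow> 'h" where
  "G_of F \<omega> x = exp (- zOU \<omega>) *\<^sub>R F (exp (zOU \<omega>) *\<^sub>R x)"

definition mild_solution ::
    "(real \<Rightarrow> 'h::{banach,second_countable_topology} \<Rightarrow>\<^sub>L 'h) \<Rightarrow> ('h \<Rightarrow> 'h) \<Rightarrow> (real \<Rightarrow> real) \<Rightarrow>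
     'h \<Rightarrow> (real \<Rightarrow> 'h) \<Rightarrow> bool" where
  "mild_solution S F \<omega> x v \<longleftrightarrow>
     continuous_on {0..} v \<and>
     (\<forall>t\<ge>0. v t = exp (zOU_int \<omega> 0 t) *\<^sub>R S t x +
        (LBINT s:{0..t}. exp (zOU_int \<omega> s t) *\<^sub>R S (t - s) (G_of F (wiener_shift s \<omega>) (v s))))"

definition unique_mild_solution ::
    "(real \<Rightarrow> 'h::{banach,second_countable_topology} \<Rightarrow>\<^sub>L 'h) \<Rightarrow> ('h \<Rightarrow> 'h) \<Rightarrow> (real \<Rightarrow> real) \<Rightarrow>
     'h \<Rightarrow> (real \<Rightarrow> 'h) \<Rightarrow> bool" where
  "unique_mild_solution S F \<omega> x v \<longleftrightarrow>
     mild_solution S F \<omega> x v \<and>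
     (\<forall>w. mild_solution S F \<omega> x w \<longrightarrow> (\<forall>t\<ge>0. w t = v t))"

definition random_dynamical_system ::
    "(real \<Rightarrow> real) measure \<Rightarrow>
     (real \<Rightarrow> (real \<Rightarrow> real) \<Rightarrow> 'h::real_normed_vector \<Rightarrow> 'h) \<Rightarrow> bool" where
  "random_dynamical_system M \<phi> \<longleftrightarrow>
     (\<lambda>(t, \<omega>, x). \<phi> t \<omega> x) \<in> restrict_space borel {0..} \<Otimes>\<^sub>M (M \<Otimes>\<^sub>M borel) \<rightarrow>\<^sub>M borel \<and>
     (\<forall>\<omega>\<in>space M. \<forall>x. \<phi> 0 \<omega> x = x) \<and>
     (\<forall>s\<ge>0. \<forall>t\<ge>0. \<forall>\<omega>\<in>space M. \<forall>x. \<phi> (s + t) \<omega> x = \<phi> t (wiener_shift s \<omega>) (\<phi> s \<omega> x))"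

definition T_map :: "(real \<Rightarrow> real) \<Rightarrow> 'h::real_vector \<Rightarrow> 'h" where
  "T_map \<omega> x = exp (- zOU \<omega>) *\<^sub>R x"

definition T_inv :: "(real \<Rightarrow> real) \<Rightarrow> 'h::real_vector \<Rightarrow> 'h" where
  "T_inv \<omega> x = exp (zOU \<omega>) *\<^sub>R x"

text \<open>The random dynamical system generated by
  \<open>du = A u dt + F(u) dt + u/2 dt + u dW\<close>, where \<open>u\<close> is the one of the random equation.\<close>

definition spde_rds ::
    "(real \<Rightarrow> (real \<Rightarrow> real) \<Rightarrow> 'h::real_vector \<Rightarrow> 'h) \<Rightarrow> real \<Rightarrow> (real \<Rightarrow> real) \<Rightarrow> 'h \<Rightarrow> 'h" where
  "spde_rds u t \<omega> x = T_inv (wiener_shift t \<omega>) (u t \<omega> (T_map \<omega> x))"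

section \<open>Stable manifolds\<close>

text \<open>The values of \<open>f\<close> on the negative half line are irrelevant.\<close>

definition C_eta_plus :: "real \<Rightarrow> (real \<Rightarrow> real) \<Rightarrow> (real \<Rightarrow> 'h::real_normed_vector) set" where
  "C_eta_plus \<eta> \<omega> =
     {f. continuous_on {0..} f \<and>
         bdd_above ((\<lambda>t. exp (- \<eta> * t - zOU_int \<omega> 0 t) * norm (f t)) ` {0..})}"

definition stable_set ::
    "(real \<Rightarrow> (real \<Rightarrow> real) \<Rightarrow> 'h::real_normed_vector \<Rightarrow> 'h) \<Rightarrow> real \<Rightarrow> (real \<Rightarrow> real) \<Rightarrow> 'h set" where
  "stable_set u \<eta> \<omega> = {x. (\<lambda>t. u t \<omega> x) \<in> C_eta_plus \<eta> \<omega>}"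

definition random_set ::
    "(real \<Rightarrow> real) measure \<Rightarrow> ((real \<Rightarrow> real) \<Rightarrow> 'h::real_normed_vector set) \<Rightarrow> bool" where
  "random_set M R \<longleftrightarrow>
     (\<forall>\<omega>\<in>space M. R \<omega> \<noteq> {} \<and> closed (R \<omega>)) \<and>
     (\<forall>x. (\<lambda>\<omega>. INF y\<in>R \<omega>. norm (x - y)) \<in> borel_measurable M)"

definition invariant_random_set ::
    "(real \<Rightarrow> real) measure \<Rightarrow> (real \<Rightarrow> (real \<Rightarrow> real) \<Rightarrow> 'h::real_normed_vector \<Rightarrow> 'h) \<Rightarrow>
     ((real \<Rightarrow> real) \<Rightarrow> 'h set) \<Rightarrow> bool" where
  "invariant_random_set M \<phi> R \<longleftrightarrow>
     random_set M R \<and>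
     (\<forall>t\<ge>0. \<forall>\<omega>\<in>space M. \<phi> t \<omega> ` R \<omega> \<subseteq> R (wiener_shift t \<omega>))"

definition lipschitz_stable_manifold ::
    "(real \<Rightarrow> real) measure \<Rightarrow> ('h::real_normed_vector \<Rightarrow>\<^sub>L 'h) \<Rightarrow>
     (real \<Rightarrow> (real \<Rightarrow> real) \<Rightarrow> 'h \<Rightarrow> 'h) \<Rightarrow> ((real \<Rightarrow> real) \<Rightarrow> 'h set) \<Rightarrow> bool" where
  "lipschitz_stable_manifold M P \<phi> R \<longleftrightarrow>
     invariant_random_set M \<phi> R \<and>
     (\<exists>h. \<forall>\<omega>\<in>space M.
        (\<lambda>\<xi>. h \<xi> \<omega>) \<in> range (compl_proj P) \<rightarrow> range P \<and>
        (\<exists>L. L-lipschitz_on (range (compl_proj P)) (\<lambda>\<xi>. h \<xi> \<omega>)) \<and>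
        R \<omega> = {\<xi> + h \<xi> \<omega> | \<xi>. \<xi> \<in> range (compl_proj P)})"

end

theory Submission
  imports Defs
begin

text \<open>
  The proof is the Lyapunov--Perron method, carried out for one realisation of the noise at a time,
  with explicit control of the dependence on the noise.

  Dividing a solution by \<open>exp (\<eta> t + \<integral>\<^sub>0\<^sup>t z)\<close> turns membership in \<open>C\<^sub>\<eta>\<^sup>+\<close> into boundedness,
  removes the random linear term, and shifts the exponents of the dichotomy to \<open>\<alpha> - \<eta> > 0\<close> and
  \<open>\<beta> - \<eta> < 0\<close> (\<open>hyperbolic_semigroup_rescale\<close>, \<open>mild_solution_iff\<close>). The nonlinearity becomes a
  conjugate of \<open>F\<close> by a positive scalar depending continuously on time, and keeps its Lipschitz
  constant. What remains is a deterministic nonautonomous equation, whose bounded solutions on the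
  half line are to be found.

  A bounded path solves that equation with stable component \<open>\<xi>\<close> of the initial value if and only if it
  is a fixed point of the Lyapunov--Perron operator with parameter \<open>\<xi>\<close> (\<open>lp_fixed_point_solution\<close>,
  \<open>solution_lp_fixed_point\<close>): the operator prescribes the unstable component of the initial value
  as the only one for which the orbit does not grow. Writing the operator as a convolution with the Green
  kernel of the dichotomy, whose mass is at most \<open>K (1 / (\<eta> - \<beta>) + 1 / (\<alpha> - \<eta>))\<close>, shows that it is a
  contraction under the gap condition. So there is exactly one bounded solution for each \<open>\<xi>\<close>, and it
  depends on \<open>\<xi>\<close> in a Lipschitz way; its initial values form the graph of a Lipschitz function
  (\<open>bounded_solution_iff\<close>, \<open>stable_fibre_lipschitz\<close>).

  Invariance is the cocycle property of \<open>u\<close> together with additivity of the weight. For the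
  measurability of the distance to the manifold, the Lipschitz function is a limit of Picard
  iterates, each of which is built from the noise by composition and integration over
  parameters and hence is measurable (\<open>fibre_measurable\<close>). The manifold is then a continuous image of
  the separable space \<open>H\<close>, and the distance to it is an infimum over a countable set
  (\<open>borel_measurable_dist_parametrized_set\<close>). The transformation \<open>T\<close> is a positive scalar for each
  \<open>\<omega>\<close>; it carries the graph, the Lipschitz constant, the invariance and the cocycle property over to
  the stochastic equation.
\<close>

section \<open>Families of operators that depend strongly continuously on time\<close>

lemma continuous_on_atLeastI:
  fixes f :: "real \<Rightarrow> 'a::topological_space"
  assumes "\<And>T. continuous_on {c..T} f"
  shows "continuous_on {c..} f"
  unfolding continuous_on_def
proof
  fix t assume t: "t \<in> {c..}"
  then have "(f \<longlongrightarrow> f t) (at t within {c..t+1})"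
    using assms[of "t + 1"] by (auto simp: continuous_on_def)
  moreover have "at t within {c..t+1} = at t within {c..}"
    by (rule at_within_nhd[of _ "{..<t+1}"]) auto
  ultimately show "(f \<longlongrightarrow> f t) (at t within {c..})" by simp
qed

text \<open>Joint continuity from separate continuity: a uniform Lipschitz bound in the space variable lets
  one freeze that variable before passing to the limit in time.\<close>

lemma continuous_on_bounded_family:
  fixes T :: "real \<Rightarrow> 'h::real_normed_vector \<Rightarrow> 'h"
  assumes diff: "\<And>r x y. r \<in> I \<Longrightarrow> norm (T r x - T r y) \<le> C * norm (x - y)"
    and cont: "\<And>x. continuous_on I (\<lambda>r. T r x)"
  shows "continuous_on (I \<times> UNIV) (\<lambda>(r, x). T r x)"
  unfolding continuous_on_def
proof (clarify)
  fix r0 :: real and x0 :: 'h assume r0: "r0 \<in> I"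
  let ?F = "at (r0, x0) within I \<times> UNIV"
  have fst: "(fst \<longlongrightarrow> r0) ?F" and snd: "(snd \<longlongrightarrow> x0) ?F"
    by (auto intro!: tendsto_eq_intros)
  have ev: "eventually (\<lambda>p. fst p \<in> I) ?F"
    unfolding eventually_at_filter by (auto intro!: always_eventually)
  have 1: "((\<lambda>p. T (fst p) x0) \<longlongrightarrow> T r0 x0) ?F"
    using continuous_on_tendsto_compose[OF cont fst r0 ev] .
  have 2: "((\<lambda>p. T (fst p) (snd p) - T (fst p) x0) \<longlongrightarrow> 0) ?F"
  proof (rule Lim_null_comparison)
    show "\<forall>\<^sub>F p in ?F. norm (T (fst p) (snd p) - T (fst p) x0) \<le> C * norm (snd p - x0)"
      using ev by eventually_elim (auto intro: diff)
    show "((\<lambda>p. C * norm (snd p - x0)) \<longlongrightarrow> 0) ?F"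
      by (rule tendsto_eq_intros snd refl)+ simp
  qed
  have "((\<lambda>p. T (fst p) (snd p)) \<longlongrightarrow> T r0 x0) ?F"
    using tendsto_add[OF 2 1] by simp
  then show "((\<lambda>(r, x). T r x) \<longlongrightarrow> T r0 x0) ?F"
    by (simp add: case_prod_unfold)
qed

text \<open>Clamping the time variable at 0 turns a family that is meaningful only for nonnegative times
  into a function on a product space, which keeps restricted measure spaces out of the sequel.\<close>

lemma borel_measurable_family_max:
  fixes T :: "real \<Rightarrow> 'h::{real_normed_vector, second_countable_topology} \<Rightarrow> 'h"
  assumes "continuous_on ({0..} \<times> UNIV) (\<lambda>(r, x). T r x)"
  shows "(\<lambda>(r, x). T (max 0 r) x) \<in> borel_measurable (borel \<Otimes>\<^sub>M borel)"
proof -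
  have "continuous_on UNIV (\<lambda>p::real \<times> 'h. (\<lambda>(r, x). T r x) (max 0 (fst p), snd p))"
    by (rule continuous_on_compose2[OF assms]) (auto intro!: continuous_intros)
  then show ?thesis
    by (simp add: borel_prod case_prod_unfold borel_measurable_continuous_onI)
qed

section \<open>Hyperbolic semigroups and the Green kernel\<close>

text \<open>The operators \<open>V t\<close> invert the semigroup on the unstable subspace, so that \<open>V t\<close> is
  \<open>S (- t)\<close> composed with \<open>P\<close>. The growth exponents of the two parts are written \<open>a\<close> and \<open>- b\<close>;
  their signs are left open because multiplying the semigroup by an exponential weight moves them.\<close>

locale hyperbolic_semigroup =
  fixes S V :: "real \<Rightarrow> 'h::{banach, second_countable_topology} \<Rightarrow>\<^sub>L 'h"
    and P :: "'h \<Rightarrow>\<^sub>L 'h"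
    and a b K :: real
  assumes semigroup: "C0_semigroup S"
    and P_idem: "P (P x) = P x"
    and P_S: "0 \<le> t \<Longrightarrow> P (S t x) = S t (P x)"
    and P_V: "0 \<le> t \<Longrightarrow> P (V t x) = V t x"
    and V_S: "0 \<le> t \<Longrightarrow> V t (S t (P x)) = P x"
    and S_V: "0 \<le> t \<Longrightarrow> S t (V t x) = P x"
    and V_bound: "0 \<le> t \<Longrightarrow> norm (V t x) \<le> K * exp (- a * t) * norm x"
    and S_bound: "0 \<le> t \<Longrightarrow> norm (S t (x - P x)) \<le> K * exp (- b * t) * norm x"
    and K_nonneg: "0 \<le> K"
begin

lemma S_0: "S 0 x = x"
  using semigroup by (simp add: C0_semigroup_def)

lemma S_add: "0 \<le> s \<Longrightarrow> 0 \<le> t \<Longrightarrow> S (s + t) x = S s (S t x)"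
  using semigroup by (simp add: C0_semigroup_def)

lemma S_cont: "continuous_on {0..} (\<lambda>t. S t x)"
  using semigroup by (simp add: C0_semigroup_def)

lemma V_P: assumes "0 \<le> t" shows "V t (P x) = V t x"
proof -
  have "V t (S t (P (V t (P x)))) = V t (S t (P (V t x)))"
    using assms by (simp add: P_V S_V P_idem)
  then show ?thesis using assms by (simp add: V_S) (simp add: P_V)
qed

lemma S_V_less: assumes "0 \<le> t" "t \<le> s" shows "S t (V s x) = V (s - t) x"
proof -
  have "V (s - t) x = V (s - t) (S s (V s x))"
    using assms by (simp add: S_V V_P)
  also have "S s (V s x) = S (s - t) (S t (V s x))"
    using assms S_add[of "s - t" t "V s x"] by simp
  also have "S t (V s x) = P (S t (V s x))"
    using assms by (simp add: P_S P_V)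
  also have "V (s - t) (S (s - t) \<dots>) = \<dots>"
    using assms V_S[of "s - t" "S t (V s x)"] by simp
  also have "P (S t (V s x)) = S t (V s x)"
    using assms by (simp add: P_S P_V)
  finally show ?thesis ..
qed

lemma S_V_greater: assumes "0 \<le> s" "s \<le> t" shows "S t (V s x) = S (t - s) (P x)"
  using assms S_add[of "t - s" s "V s x"] by (simp add: S_V)

text \<open>Backward orbits inherit strong continuity from forward ones: on \<open>{0..T}\<close> the backward orbit of
  \<open>x\<close> is the forward orbit of \<open>V T x\<close> run in reverse.\<close>

lemma V_cont: "continuous_on {0..} (\<lambda>t. V t x)"
proof (rule continuous_on_atLeastI)
  fix T :: real
  have "continuous_on {0..T} (\<lambda>r. S (T - r) (V T x))"
    by (rule continuous_on_compose2[OF S_cont]) (auto intro!: continuous_intros)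
  then show "continuous_on {0..T} (\<lambda>r. V r x)"
    by (rule continuous_on_eq) (auto simp: S_V_less)
qed

text \<open>The Green kernel of the dichotomy: the stable part propagates influences forward in time
  (\<open>r > 0\<close>), the unstable part backward (\<open>r \<le> 0\<close>). At \<open>r = 0\<close> it is the unstable value \<open>- P x\<close>, so
  that an integral over \<open>r \<le> 0\<close> lies in the range of \<open>P\<close> without discarding a null set.\<close>

definition green :: "real \<Rightarrow> 'h \<Rightarrow> 'h" where
  "green r x = (if r \<le> 0 then - V (- r) x else S r (x - P x))"

definition green_envelope :: "real \<Rightarrow> real" where
  "green_envelope r = K * (if r \<le> 0 then exp (a * r) else exp (- b * r))"

lemma green_envelope_nonneg: "0 \<le> green_envelope r"
  by (simp add: green_envelope_def K_nonneg)

lemma green_0 [simp]: "green r 0 = 0"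
  by (simp add: green_def)

lemma green_diff: "green r x - green r y = green r (x - y)"
  by (simp add: green_def blinfun.diff_right)

lemma isCont_green: "isCont (green r) x"
  unfolding green_def[abs_def]
  by (cases "r \<le> 0") (auto intro!: continuous_intros)

text \<open>Only the two components of \<open>x\<close> enter, each measured separately; this is why the Lipschitz
  condition on the nonlinearity is stated for the projections.\<close>

lemma green_bound:
  assumes "norm (P x) \<le> M" "norm (compl_proj P x) \<le> M"
  shows "norm (green r x) \<le> green_envelope r * M"
proof (cases "r \<le> 0")
  case True
  have "norm (V (- r) (P x)) \<le> K * exp (a * r) * norm (P x)"
    using V_bound[of "- r" "P x"] True by simp
  also have "\<dots> \<le> K * exp (a * r) * M"
    using assms K_nonneg by (intro mult_left_mono) auto
  finally show ?thesis using True by (simp add: green_def green_envelope_def V_P)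
next
  case False
  have c: "compl_proj P x = x - P x" by (simp add: compl_proj_def blinfun.diff_left)
  have "norm (S r ((x - P x) - P (x - P x))) \<le> K * exp (- b * r) * norm (x - P x)"
    using S_bound[of r "x - P x"] False by simp
  also have "\<dots> \<le> K * exp (- b * r) * M"
    using assms K_nonneg by (intro mult_left_mono) (auto simp: c)
  finally show ?thesis using False by (simp add: green_def green_envelope_def blinfun.diff_right P_idem)
qed

text \<open>The kernel seen at time \<open>t\<close> is the kernel seen at time 0, transported by the semigroup, plus
  the causal part of the semigroup. This pointwise identity is what relates the Lyapunov--Perron
  equation to the variation of constants formula; it fails at \<open>s = t\<close>, where the kernel jumps.\<close>

lemma green_split:
  assumes "0 \<le> s" "0 \<le> t" "s \<noteq> t"
  shows "green (t - s) x = S t (green (- s) x) + (if s \<le> t then S (t - s) x else 0)"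
  using assms
  by (auto simp: green_def blinfun.minus_right blinfun.diff_right S_V_less S_V_greater)

end

text \<open>Positive \<open>a\<close> and \<open>b\<close> make the Green kernel integrable over the line, with total mass at most
  \<open>K (1 / b + 1 / a)\<close>, the constant in the gap condition.\<close>

locale gapped_semigroup = hyperbolic_semigroup +
  assumes a_pos: "0 < a" and b_pos: "0 < b"
begin

lemma green_measurable: "(\<lambda>(r, x). green r x) \<in> borel_measurable (borel \<Otimes>\<^sub>M borel)"
proof -
  have S: "norm (S r (x - P x) - S r (y - P y)) \<le> K * norm (x - y)" if "r \<in> {0..}" for r x y
  proof -
    have "norm (S r (x - P x) - S r (y - P y)) = norm (S r ((x - y) - P (x - y)))"
      unfolding blinfun.diff_right by (simp add: algebra_simps)
    also have "\<dots> \<le> K * exp (- b * r) * norm (x - y)"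
      using that S_bound by simp
    also have "\<dots> \<le> K * 1 * norm (x - y)"
      using that b_pos K_nonneg by (intro mult_right_mono mult_left_mono) auto
    finally show ?thesis by simp
  qed
  have V: "norm (V r x - V r y) \<le> K * norm (x - y)" if "r \<in> {0..}" for r x y
  proof -
    have "norm (V r x - V r y) \<le> K * exp (- a * r) * norm (x - y)"
      using V_bound[of r "x - y"] that by (simp add: blinfun.diff_right)
    also have "\<dots> \<le> K * 1 * norm (x - y)"
      using that a_pos K_nonneg by (intro mult_right_mono mult_left_mono) auto
    finally show ?thesis by simp
  qed
  have S' [measurable]: "(\<lambda>(r, x). S (max 0 r) (x - P x)) \<in> borel_measurable (borel \<Otimes>\<^sub>M borel)"
    by (rule borel_measurable_family_max[OF continuous_on_bounded_family[OF S]])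
       (auto intro: S_cont)
  have V' [measurable]: "(\<lambda>(r, x). V (max 0 r) x) \<in> borel_measurable (borel \<Otimes>\<^sub>M borel)"
    by (rule borel_measurable_family_max[OF continuous_on_bounded_family[OF V]])
       (auto intro: V_cont)
  have "(\<lambda>p. if fst p \<le> 0 then - (\<lambda>(r, x). V (max 0 r) x) (- fst p, snd p)
           else (\<lambda>(r, x). S (max 0 r) (x - P x)) p) \<in> borel_measurable (borel \<Otimes>\<^sub>M borel)"
    by measurable
  also have "(\<lambda>p. if fst p \<le> 0 then - (\<lambda>(r, x). V (max 0 r) x) (- fst p, snd p)
           else (\<lambda>(r, x). S (max 0 r) (x - P x)) p) = (\<lambda>(r, x). green r x)"
    by (auto simp: fun_eq_iff green_def)
  finally show ?thesis .
qed

lemma borel_measurable_green [measurable (raw)]: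
  assumes [measurable]: "f \<in> borel_measurable M" "h \<in> borel_measurable M"
  shows "(\<lambda>x. green (f x) (h x)) \<in> borel_measurable M"
proof -
  have "(\<lambda>x. (\<lambda>(r, x). green r x) (f x, h x)) \<in> borel_measurable M"
    by (rule measurable_compose[OF _ green_measurable]) measurable
  then show ?thesis by simp
qed

lemma has_bochner_integral_green_envelope:
  "has_bochner_integral lborel green_envelope (K * (1 / b + 1 / a))"
proof -
  have half: "has_bochner_integral lborel (\<lambda>r. indicator {0..} r *\<^sub>R exp (- c * r)) (1 / c)"
    if "0 < c" for c :: real
  proof (rule has_bochner_integral_nn_integral)
    show "(\<integral>\<^sup>+r. indicator {0..} r *\<^sub>R exp (- c * r) \<partial>lborel) = ennreal (1 / c)"
      using nn_integral_has_integral_lebesgue[OF _ has_integral_exp_minus_to_infinity[OF that, of 0]]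
      by simp
  qed (use that in auto)
  have neg: "has_bochner_integral lborel (\<lambda>r. indicator {..0} r *\<^sub>R exp (a * r)) (1 / a)"
  proof -
    have "has_bochner_integral lborel (\<lambda>r. indicator {0..} (0 + (-1) * r) *\<^sub>R exp (- a * (0 + (-1) * r))) (1 / a)"
      using half[OF a_pos] lborel_integrable_real_affine[of "\<lambda>r. indicator {0..} r *\<^sub>R exp (- a * r)" "-1" 0]
        lborel_integral_real_affine[of "-1" "\<lambda>r. indicator {0..} r *\<^sub>R exp (- a * r)" 0]
      by (simp add: has_bochner_integral_iff)
    then show ?thesis by (simp add: indicator_def)
  qed
  have pos: "has_bochner_integral lborel (\<lambda>r. indicator {0<..} r *\<^sub>R exp (- b * r)) (1 / b)"
    using half[OF b_pos]
    by (rule has_bochner_integral_discrete_difference[where X = "{0}", THEN iffD1, rotated -1])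
       (auto simp: indicator_def)
  have "has_bochner_integral lborel (\<lambda>r. K * (indicator {0<..} r *\<^sub>R exp (- b * r) +
      indicator {..0} r *\<^sub>R exp (a * r))) (K * (1 / b + 1 / a))"
    by (intro has_bochner_integral_mult_right has_bochner_integral_add pos neg)
  moreover have "(\<lambda>r. K * (indicator {0<..} r *\<^sub>R exp (- b * r) +
      indicator {..0} r *\<^sub>R exp (a * r))) = green_envelope"
    by (auto simp: fun_eq_iff green_envelope_def indicator_def)
  ultimately show ?thesis by simp
qed

lemma integrable_green_envelope: "integrable lborel green_envelope"
  using has_bochner_integral_green_envelope by (simp add: has_bochner_integral_iff)

end

section \<open>Bounded solutions of the semilinear equation\<close>

definition bounded_path :: "(real \<Rightarrow> 'h::real_normed_vector) \<Rightarrow> bool" where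
  "bounded_path f \<longleftrightarrow> continuous_on {0..} f \<and> bounded (f ` {0..})"

lemma bounded_pathE:
  assumes "bounded_path f"
  obtains C where "0 \<le> C" "\<And>t. 0 \<le> t \<Longrightarrow> norm (f t) \<le> C"
proof -
  from assms obtain C where "\<And>t. 0 \<le> t \<Longrightarrow> norm (f t) \<le> C"
    by (auto simp: bounded_path_def bounded_iff)
  moreover from this[of 0] have "0 \<le> C" using norm_ge_zero order_trans by blast
  ultimately show thesis using that by blast
qed

lemma bounded_path_cong:
  assumes "\<And>t. 0 \<le> t \<Longrightarrow> f t = h t" "bounded_path f"
  shows "bounded_path h"
proof -
  have "f ` {0..} = h ` {0..}" using assms(1) by (intro image_cong) auto
  then show ?thesis
    using assms continuous_on_eq[of "{0..}" f h] by (simp add: bounded_path_def)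
qed

text \<open>A nonautonomous semilinear equation \<open>v' = A v + g t v\<close> whose nonlinearity is small compared
  with the gap. The bounded paths stand for the weighted space of the original problem, from which
  the weight has been divided out.\<close>

locale lyapunov_perron = gapped_semigroup +
  fixes g :: "real \<Rightarrow> 'a \<Rightarrow> 'a" and L :: real
  assumes g_cont: "continuous_on ({0..} \<times> UNIV) (\<lambda>(s, x). g s x)"
    and g_zero: "0 \<le> s \<Longrightarrow> g s 0 = 0"
    and g_lip: "0 \<le> s \<Longrightarrow> proj_lipschitz P L (g s)"
    and L_nonneg: "0 \<le> L"
    and gap: "K * L * (1 / b + 1 / a) < 1"
begin

text \<open>The inhomogeneity along a path, set to 0 before time 0 so that the Lyapunov--Perron
  integral becomes a convolution over the whole line.\<close>

definition force :: "(real \<Rightarrow> 'a) \<Rightarrow> real \<Rightarrow> 'a" where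
  "force f s = (if 0 \<le> s then g s (f s) else 0)"

text \<open>The Lyapunov--Perron operator
  \<open>S t \<xi> + \<integral>\<^sub>0\<^sup>t S (t - s) P\<^sup>- g s (f s) ds - \<integral>\<^sub>t\<^sup>\<infinity> V (s - t) g s (f s) ds\<close>, in which both
  integrals are collected in one convolution with the Green kernel.\<close>

definition lp :: "'a \<Rightarrow> (real \<Rightarrow> 'a) \<Rightarrow> real \<Rightarrow> 'a" where
  "lp \<xi> f t = S t \<xi> + (\<integral>r. green r (force f (t - r)) \<partial>lborel)"

definition contraction_const :: real where
  "contraction_const = K * L * (1 / b + 1 / a)"

lemma contraction_const: "0 \<le> contraction_const" "contraction_const < 1"
  using gap K_nonneg L_nonneg a_pos b_pos by (auto simp: contraction_const_def)

lemma force_cont: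
  assumes f: "continuous_on {0..} f"
  shows "continuous_on {0..} (force f)"
proof -
  have "continuous_on {0..} (\<lambda>s. (\<lambda>(s, x). g s x) (s, f s))"
    by (rule continuous_on_compose2[OF g_cont]) (auto intro!: continuous_intros f)
  then show ?thesis
    by (rule continuous_on_eq) (simp add: force_def)
qed

lemma force_measurable:
  assumes "continuous_on {0..} f"
  shows "force f \<in> borel_measurable borel"
proof -
  have "(\<lambda>s. indicator {0..} s *\<^sub>R force f s) \<in> borel_measurable borel"
    by (rule borel_measurable_continuous_on_indicator[OF _ force_cont[OF assms]]) simp
  also have "(\<lambda>s. indicator {0..} s *\<^sub>R force f s) = force f"
    by (auto simp: fun_eq_iff force_def indicator_def)
  finally show ?thesis .
qed

lemma force_lip:
  assumes "\<And>t. 0 \<le> t \<Longrightarrow> norm (f t - h t) \<le> D" "0 \<le> D"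
  shows "norm (P (force f s - force h s)) \<le> L * D"
    and "norm (compl_proj P (force f s - force h s)) \<le> L * D"
proof -
  have "norm (P (force f s - force h s)) \<le> L * norm (f s - h s) \<and>
      norm (compl_proj P (force f s - force h s)) \<le> L * norm (f s - h s)" if "0 \<le> s"
    using g_lip[OF that] that by (simp add: force_def proj_lipschitz_def)
  moreover have "L * norm (f s - h s) \<le> L * D" if "0 \<le> s"
    using assms that L_nonneg by (intro mult_left_mono) auto
  moreover have "0 \<le> L * D" using assms L_nonneg by simp
  ultimately show "norm (P (force f s - force h s)) \<le> L * D"
    "norm (compl_proj P (force f s - force h s)) \<le> L * D"
    by (cases "0 \<le> s"; force simp: force_def)+
qed

lemma green_force_diff:
  assumes "\<And>t. 0 \<le> t \<Longrightarrow> norm (f t - h t) \<le> D" "0 \<le> D"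
  shows "norm (green r (force f s) - green r (force h s)) \<le> green_envelope r * (L * D)"
  unfolding green_diff by (intro green_bound force_lip assms)

lemma green_force_bound:
  assumes "\<And>t. 0 \<le> t \<Longrightarrow> norm (f t) \<le> C" "0 \<le> C"
  shows "norm (green r (force f s)) \<le> green_envelope r * (L * C)"
proof -
  have "force (\<lambda>_. 0) s = 0" by (simp add: force_def g_zero)
  then show ?thesis
    using green_force_diff[of f "\<lambda>_. 0" C r s] assms by simp
qed

lemma integrable_green_envelope_mult: "integrable lborel (\<lambda>r. green_envelope r * c)"
  using integrable_green_envelope by simp

lemma integral_green_envelope_mult: "(\<integral>r. green_envelope r * (L * c) \<partial>lborel) = contraction_const * c"
  using has_bochner_integral_green_envelope
  by (simp add: has_bochner_integral_iff contraction_const_def)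

lemma lp_integrable:
  assumes f: "bounded_path f"
  shows "integrable lborel (\<lambda>r. green r (force f (t - r)))"
proof -
  obtain C where C: "0 \<le> C" "\<And>t. 0 \<le> t \<Longrightarrow> norm (f t) \<le> C"
    using bounded_pathE[OF f] by blast
  have [measurable]: "force f \<in> borel_measurable borel"
    using f by (simp add: bounded_path_def force_measurable)
  show ?thesis
  proof (rule Bochner_Integration.integrable_bound[OF integrable_green_envelope_mult[of "L * C"]])
    show "AE r in lborel. norm (green r (force f (t - r))) \<le> norm (green_envelope r * (L * C))"
      using green_force_bound[OF C(2,1)] L_nonneg C(1) green_envelope_nonneg by (intro AE_I2) simp
  qed measurable
qed

lemma lp_diff:
  assumes f: "bounded_path f" and h: "bounded_path h"
    and D: "\<And>t. 0 \<le> t \<Longrightarrow> norm (f t - h t) \<le> D" "0 \<le> D"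
  shows "norm (lp \<xi> f t - lp \<zeta> h t) \<le> norm (S t (\<xi> - \<zeta>)) + contraction_const * D"
proof -
  let ?I = "\<integral>r. green r (force f (t - r)) - green r (force h (t - r)) \<partial>lborel"
  have eq: "lp \<xi> f t - lp \<zeta> h t = S t (\<xi> - \<zeta>) + ?I"
    using lp_integrable[OF f] lp_integrable[OF h]
    by (simp add: lp_def blinfun.diff_right)
  have "norm ?I \<le> (\<integral>r. green_envelope r * (L * D) \<partial>lborel)"
  proof (rule Bochner_Integration.integral_norm_bound_integral)
    show "integrable lborel (\<lambda>r. green r (force f (t - r)) - green r (force h (t - r)))"
      by (rule Bochner_Integration.integrable_diff[OF lp_integrable[OF f] lp_integrable[OF h]])
    show "integrable lborel (\<lambda>r. green_envelope r * (L * D))"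
      by (rule integrable_green_envelope_mult)
    show "norm (green r (force f (t - r)) - green r (force h (t - r))) \<le> green_envelope r * (L * D)" for r
      using green_force_diff[of f h D r "t - r"] D by blast
  qed
  then have "norm ?I \<le> contraction_const * D" by (simp only: integral_green_envelope_mult)
  with norm_triangle_ineq[of "S t (\<xi> - \<zeta>)" ?I] show ?thesis
    unfolding eq by linarith
qed

lemma S_stable_le:
  assumes "P \<xi> = 0" "0 \<le> t" shows "norm (S t \<xi>) \<le> K * norm \<xi>"
proof -
  have "norm (S t \<xi>) \<le> K * exp (- b * t) * norm \<xi>"
    using S_bound[OF assms(2), of \<xi>] assms(1) by simp
  also have "\<dots> \<le> K * 1 * norm \<xi>"
    using assms K_nonneg b_pos by (intro mult_right_mono mult_left_mono) auto
  finally show ?thesis by simp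
qed

lemma lp_zero: "lp 0 (\<lambda>_. 0) t = 0"
proof -
  have "force (\<lambda>_. 0) = (\<lambda>_. 0)" by (auto simp: fun_eq_iff force_def g_zero)
  then show ?thesis by (simp add: lp_def)
qed

lemma bounded_path_zero: "bounded_path (\<lambda>_. 0)"
  by (auto simp: bounded_path_def bounded_iff)

text \<open>In the convolution form the variable \<open>t\<close> enters the integrand only through the force, and the
  envelope of the Green kernel dominates the integrand uniformly in \<open>t\<close>. Continuity of the image is
  therefore dominated convergence: for fixed \<open>r \<noteq> t\<close> the force is continuous at \<open>t - r\<close>.\<close>

lemma lp_bounded_path:
  assumes f: "bounded_path f" and \<xi>: "P \<xi> = 0"
  shows "bounded_path (lp \<xi> f)"
  unfolding bounded_path_def
proof
  obtain C where C: "0 \<le> C" "\<And>t. 0 \<le> t \<Longrightarrow> norm (f t) \<le> C"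
    using bounded_pathE[OF f] by blast
  have fc: "continuous_on {0..} (force f)" 
    using f by (simp add: bounded_path_def force_cont)
  have [measurable]: "force f \<in> borel_measurable borel"
    using f by (simp add: bounded_path_def force_measurable)
  have "norm (lp \<xi> f t) \<le> K * norm \<xi> + contraction_const * C" if "0 \<le> t" for t
    using lp_diff[OF f bounded_path_zero, of C \<xi> t 0] C S_stable_le[OF \<xi> that]
    by (simp add: lp_zero)
  then show "bounded (lp \<xi> f ` {0..})" by (auto simp: bounded_iff)
  have force_isCont: "isCont (force f) s" if "s \<noteq> 0" for s
  proof (cases "0 < s")
    case True
    then have "continuous (at s within {0..}) (force f)"
      using fc by (simp add: continuous_on_eq_continuous_within)
    moreover have "at s within {0..} = at s" using True by (intro at_within_interior) simp
    ultimately show ?thesis by (simp add: continuous_within)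
  next
    case False
    have "continuous_on {..<0} (force f)"
      by (rule continuous_on_eq[OF continuous_on_const[of _ 0]]) (simp add: force_def)
    then show ?thesis using False that by (simp add: continuous_on_eq_continuous_at)
  qed
  have "((\<lambda>n. \<integral>r. green r (force f (X n - r)) \<partial>lborel) \<longlonglongrightarrow>
      (\<integral>r. green r (force f (t - r)) \<partial>lborel))" if X: "X \<longlonglongrightarrow> t" for X t
  proof (rule integral_dominated_convergence[where w = "\<lambda>r. green_envelope r * (L * C)"])
    show "AE r in lborel. (\<lambda>n. green r (force f (X n - r))) \<longlonglongrightarrow> green r (force f (t - r))"
      using AE_lborel_singleton[of t]
    proof eventually_elim
      case (elim r)
      have "(\<lambda>n. X n - r) \<longlonglongrightarrow> t - r" by (intro tendsto_intros X)
      moreover have "isCont (force f) (t - r)" using elim by (intro force_isCont) simp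
      ultimately show ?case
        by (intro isCont_tendsto_compose[OF isCont_green] isCont_tendsto_compose[of _ "force f"])
    qed
    show "integrable lborel (\<lambda>r. green_envelope r * (L * C))"
      by (rule integrable_green_envelope_mult)
  qed (use green_force_bound[OF C(2,1)] in auto)
  then have "continuous_on {0..} (\<lambda>t. \<integral>r. green r (force f (t - r)) \<partial>lborel)"
    by (auto simp: continuous_on_sequentially o_def)
  then show "continuous_on {0..} (lp \<xi> f)"
    unfolding lp_def[abs_def] by (intro continuous_on_add S_cont)
qed

text \<open>Banach's fixed point theorem on the bounded continuous functions on the whole line, to which
  paths are extended by their value at 0.\<close>

lemma lp_fixed_point:
  assumes \<xi>: "P \<xi> = 0"
  obtains f where "bounded_path f" "\<And>t. 0 \<le> t \<Longrightarrow> lp \<xi> f t = f t"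
proof -
  define \<Phi> where "\<Phi> f = Bcontfun (\<lambda>t. lp \<xi> (apply_bcontfun f) (max 0 t))" for f :: "real \<Rightarrow>\<^sub>C 'a"
  have bp: "bounded_path (apply_bcontfun f)" for f :: "real \<Rightarrow>\<^sub>C 'a"
    unfolding bounded_path_def
    by (intro conjI continuous_on_apply_bcontfun bounded_subset[OF bounded_apply_bcontfun[of f]]) blast
  have ap: "apply_bcontfun (\<Phi> f) t = lp \<xi> (apply_bcontfun f) (max 0 t)" for f t
  proof -
    have *: "bounded_path (lp \<xi> (apply_bcontfun f))" by (rule lp_bounded_path[OF bp \<xi>])
    then have "continuous_on {0..} (lp \<xi> (apply_bcontfun f))"
      by (simp add: bounded_path_def)
    then have "continuous_on UNIV (\<lambda>t. lp \<xi> (apply_bcontfun f) (max 0 t))"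
      by (rule continuous_on_compose2) (auto intro!: continuous_intros)
    moreover have "bounded (range (\<lambda>t. lp \<xi> (apply_bcontfun f) (max 0 t)))"
      by (rule bounded_subset[of "lp \<xi> (apply_bcontfun f) ` {0..}"])
         (use * in \<open>auto simp: bounded_path_def\<close>)
    ultimately have "(\<lambda>t. lp \<xi> (apply_bcontfun f) (max 0 t)) \<in> bcontfun"
      by (simp add: bcontfun_def)
    then show ?thesis by (simp add: \<Phi>_def Bcontfun_inverse)
  qed
  have "dist (\<Phi> f) (\<Phi> h) \<le> contraction_const * dist f h" for f h
  proof (rule dist_bound)
    fix t
    have "norm (lp \<xi> f (max 0 t) - lp \<xi> h (max 0 t)) \<le> norm (S (max 0 t) (\<xi> - \<xi>)) + contraction_const * dist f h"
      by (rule lp_diff[OF bp bp]) (auto simp: dist_norm[symmetric] dist_bounded)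
    then show "dist (\<Phi> f t) (\<Phi> h t) \<le> contraction_const * dist f h"
      by (simp add: ap dist_norm)
  qed
  then obtain f where f: "\<Phi> f = f"
    using banach_fix_type[OF contraction_const, of \<Phi>] by blast
  show thesis
  proof (rule that[OF bp])
    fix t :: real assume "0 \<le> t"
    then show "lp \<xi> (apply_bcontfun f) t = apply_bcontfun f t"
      using ap[of f t] by (simp add: f)
  qed
qed

text \<open>A bounded quantity that improves from any bound \<open>D'\<close> to \<open>c + q D'\<close>, with \<open>q < 1\<close> the
  contraction constant, is bounded by \<open>c / (1 - q)\<close>: iterate the improvement.\<close>

lemma bound_of_contraction:
  assumes "\<And>D'. (\<And>t::real. 0 \<le> t \<Longrightarrow> d t \<le> D') \<Longrightarrow> 0 \<le> D' \<Longrightarrow> (\<And>t. 0 \<le> t \<Longrightarrow> d t \<le> c + contraction_const * D')"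
    and "\<And>t. 0 \<le> t \<Longrightarrow> d t \<le> D" "0 \<le> D" "0 \<le> c" "0 \<le> t"
  shows "d t \<le> c / (1 - contraction_const)"
proof -
  have "\<forall>t\<ge>0. d t \<le> c / (1 - contraction_const) + contraction_const ^ n * D" for n
  proof (induction n)
    case 0
    show ?case using assms(2,4) contraction_const by (auto intro!: add_increasing)
  next
    case (Suc n)
    have "d t \<le> c + contraction_const * (c / (1 - contraction_const) + contraction_const ^ n * D)" if "0 \<le> t" for t
      using assms(1)[OF Suc[rule_format] _ that] assms(3,4) contraction_const by simp
    also have "c + contraction_const * (c / (1 - contraction_const) + contraction_const ^ n * D) = c / (1 - contraction_const) + contraction_const ^ Suc n * D"
      using contraction_const by (simp add: field_simps)
    finally show ?case by blast
  qed
  then have *: "d t \<le> c / (1 - contraction_const) + contraction_const ^ n * D" for n using assms(5) by blast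
  have "(\<lambda>n. c / (1 - contraction_const) + contraction_const ^ n * D) \<longlonglongrightarrow> c / (1 - contraction_const) + 0 * D"
    by (intro tendsto_intros LIMSEQ_realpow_zero contraction_const)
  then show ?thesis
    using * by (intro LIMSEQ_le_const[where a = "d t"]) auto
qed

lemma lp_fixed_points_dist:
  assumes f: "bounded_path f" "\<And>t. 0 \<le> t \<Longrightarrow> lp \<xi> f t = f t" "P \<xi> = 0"
    and h: "bounded_path h" "\<And>t. 0 \<le> t \<Longrightarrow> lp \<zeta> h t = h t" "P \<zeta> = 0"
    and t: "0 \<le> t"
  shows "norm (f t - h t) \<le> K * norm (\<xi> - \<zeta>) / (1 - contraction_const)"
proof -
  obtain C C' where "0 \<le> C" "\<And>t. 0 \<le> t \<Longrightarrow> norm (f t) \<le> C"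
    "0 \<le> C'" "\<And>t. 0 \<le> t \<Longrightarrow> norm (h t) \<le> C'"
    using bounded_pathE[OF f(1)] bounded_pathE[OF h(1)] by metis
  note C = this
  have D: "norm (f t - h t) \<le> C + C'" if "0 \<le> t" for t
    using C(2,4)[OF that] norm_triangle_ineq4[of "f t" "h t"] by linarith
  show ?thesis
  proof (rule bound_of_contraction[where d = "\<lambda>t. norm (f t - h t)" and D = "C + C'"])
    fix D' t :: real
    assume D': "\<And>t. 0 \<le> t \<Longrightarrow> norm (f t - h t) \<le> D'" "0 \<le> D'" and t: "0 \<le> t"
    have "norm (lp \<xi> f t - lp \<zeta> h t) \<le> norm (S t (\<xi> - \<zeta>)) + contraction_const * D'"
      by (rule lp_diff[OF f(1) h(1) D'])
    also have "norm (S t (\<xi> - \<zeta>)) \<le> K * norm (\<xi> - \<zeta>)"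
      using t f(3) h(3) by (intro S_stable_le) (auto simp: blinfun.diff_right)
    finally show "norm (f t - h t) \<le> K * norm (\<xi> - \<zeta>) + contraction_const * D'"
      using f(2) h(2) t by simp
  qed (use D C(1,3) t K_nonneg in auto)
qed

text \<open>The fixed point is also needed as an explicit limit: the iterates below depend measurably on
  every parameter of the equation, and the measurability passes to the limit.\<close>

definition picard :: "'a \<Rightarrow> nat \<Rightarrow> real \<Rightarrow> 'a" where
  "picard \<xi> n = (lp \<xi> ^^ n) (\<lambda>_. 0)"

lemma picard_Suc: "picard \<xi> (Suc n) = lp \<xi> (picard \<xi> n)"
  by (simp add: picard_def)

lemma picard_limit:
  assumes f: "bounded_path f" "\<And>t. 0 \<le> t \<Longrightarrow> lp \<xi> f t = f t" "P \<xi> = 0" and t: "0 \<le> t"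
  shows "(\<lambda>n. picard \<xi> n t) \<longlonglongrightarrow> f t"
proof -
  obtain C where C: "0 \<le> C" "\<And>t. 0 \<le> t \<Longrightarrow> norm (f t) \<le> C"
    using bounded_pathE[OF f(1)] by blast
  have "bounded_path (picard \<xi> n) \<and> (\<forall>t\<ge>0. norm (picard \<xi> n t - f t) \<le> contraction_const ^ n * C)" for n
  proof (induction n)
    case 0
    show ?case using C by (simp add: picard_def bounded_path_zero)
  next
    case (Suc n)
    then have b: "bounded_path (picard \<xi> n)" by simp
    have "norm (lp \<xi> (picard \<xi> n) t - lp \<xi> f t) \<le> norm (S t (\<xi> - \<xi>)) + contraction_const * (contraction_const ^ n * C)" for t
      by (rule lp_diff[OF b f(1)]) (use Suc C contraction_const in auto)
    then have "norm (picard \<xi> (Suc n) t - lp \<xi> f t) \<le> contraction_const ^ Suc n * C" for t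
      by (simp add: picard_Suc mult.assoc)
    then have "norm (picard \<xi> (Suc n) t - f t) \<le> contraction_const ^ Suc n * C" if "0 \<le> t" for t
      unfolding f(2)[OF that, symmetric] .
    moreover have "bounded_path (picard \<xi> (Suc n))"
      unfolding picard_Suc by (rule lp_bounded_path[OF b f(3)])
    ultimately show ?case by blast
  qed
  then have *: "norm (picard \<xi> n t - f t) \<le> contraction_const ^ n * C" for n using t by blast
  have "(\<lambda>n. contraction_const ^ n * C) \<longlonglongrightarrow> 0 * C"
    by (intro tendsto_intros LIMSEQ_realpow_zero contraction_const)
  then have "(\<lambda>n. picard \<xi> n t - f t) \<longlonglongrightarrow> 0"
    using Lim_null_comparison[of "\<lambda>n. picard \<xi> n t - f t" "\<lambda>n. contraction_const ^ n * C"] * by simp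
  then show ?thesis by (simp add: LIM_zero_iff)
qed

text \<open>At time 0 only nonpositive \<open>r\<close> contribute to the convolution, hence only unstable values.\<close>

lemma P_lp_0:
  assumes f: "bounded_path f" and \<xi>: "P \<xi> = 0"
  shows "P (lp \<xi> f 0) = lp \<xi> f 0 - \<xi>"
proof -
  have "P (\<integral>r. green r (force f (0 - r)) \<partial>lborel) = (\<integral>r. P (green r (force f (0 - r))) \<partial>lborel)"
    by (rule integral_bounded_linear[symmetric, OF blinfun.bounded_linear_right lp_integrable[OF f]])
  also have "\<dots> = (\<integral>r. green r (force f (0 - r)) \<partial>lborel)"
  proof (rule Bochner_Integration.integral_cong[OF refl])
    fix r
    show "P (green r (force f (0 - r))) = green r (force f (0 - r))"
      by (cases "r \<le> 0") (simp_all add: green_def force_def blinfun.minus_right P_V)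
  qed
  finally show ?thesis
    by (simp add: lp_def S_0 blinfun.add_right \<xi>)
qed

text \<open>The image of any bounded path satisfies a variation of constants formula, started at its own
  value at time 0. It is the integrated form of the splitting of the Green kernel.\<close>

lemma lp_eq_flow:
  assumes f: "bounded_path f" and t: "0 \<le> t"
  shows "lp \<xi> f t = S t (lp \<xi> f 0) + (LBINT s:{0..t}. S (t - s) (g s (f s)))"
proof -
  have reflect: "(\<integral>r. green r (force f (t - r)) \<partial>lborel) = (\<integral>s. green (t - s) (force f s) \<partial>lborel)"
    "integrable lborel (\<lambda>s. green (t - s) (force f s))" for t
    using lborel_integral_real_affine[of "-1" "\<lambda>r. green r (force f (t - r))" t]
      lborel_integrable_real_affine[OF lp_integrable[OF f, of t], of "-1" t] by auto
  have S: "integrable lborel (\<lambda>s. S t (green (0 - s) (force f s)))"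
    "(\<integral>s. S t (green (0 - s) (force f s)) \<partial>lborel) = S t (\<integral>s. green (0 - s) (force f s) \<partial>lborel)"
    using integrable_bounded_linear[OF blinfun.bounded_linear_right reflect(2)]
      integral_bounded_linear[OF blinfun.bounded_linear_right reflect(2)] by blast+
  have "lp \<xi> f t - S t (lp \<xi> f 0) =
      (\<integral>s. green (t - s) (force f s) \<partial>lborel) - (\<integral>s. S t (green (0 - s) (force f s)) \<partial>lborel)"
    unfolding lp_def reflect(1) S(2) by (simp add: S_0 blinfun.add_right)
  also have "\<dots> = (\<integral>s. green (t - s) (force f s) - S t (green (0 - s) (force f s)) \<partial>lborel)"
    by (rule Bochner_Integration.integral_diff[symmetric, OF reflect(2) S(1)])
  also have "\<dots> = (\<integral>s. indicator {0..t} s *\<^sub>R S (t - s) (g s (f s)) \<partial>lborel)"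
  \<comment> \<open>the splitting of the kernel fails only at the single point \<open>s = t\<close>\<close>
  proof (rule integral_discrete_difference[where X = "{t}"])
    fix s assume "s \<notin> {t}"
    then show "green (t - s) (force f s) - S t (green (0 - s) (force f s)) =
        indicator {0..t} s *\<^sub>R S (t - s) (g s (f s))"
      using green_split[of s t] t by (cases "0 \<le> s") (auto simp: force_def indicator_def)
  qed auto
  finally show ?thesis by (simp add: set_lebesgue_integral_def algebra_simps)
qed

definition solution :: "'a \<Rightarrow> (real \<Rightarrow> 'a) \<Rightarrow> bool" where
  "solution x f \<longleftrightarrow> continuous_on {0..} f \<and>
     (\<forall>t\<ge>0. f t = S t x + (LBINT s:{0..t}. S (t - s) (g s (f s))))"

lemma lp_fixed_point_solution:
  assumes "bounded_path f" "\<And>t. 0 \<le> t \<Longrightarrow> lp \<xi> f t = f t"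
  shows "solution (f 0) f"
  unfolding solution_def
proof (intro conjI allI impI)
  fix t :: real assume "0 \<le> t"
  with lp_eq_flow[OF assms(1) this, of \<xi>] assms(2)
  show "f t = S t (f 0) + (LBINT s:{0..t}. S (t - s) (g s (f s)))" by simp
qed (use assms in \<open>simp add: bounded_path_def\<close>)

text \<open>Conversely, a bounded solution differs from its Lyapunov--Perron image by an orbit \<open>S t y\<close> with
  \<open>y\<close> unstable. This orbit is bounded, whereas nonzero unstable orbits grow like \<open>exp (a t)\<close>; so
  \<open>y = 0\<close>.\<close>

lemma solution_lp_fixed_point:
  assumes f: "solution x f" "bounded_path f"
  shows "f 0 = x" and "0 \<le> t \<Longrightarrow> lp (x - P x) f t = f t"
proof -
  define \<xi> where "\<xi> = x - P x"
  have \<xi>: "P \<xi> = 0" by (simp add: \<xi>_def blinfun.diff_right P_idem)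
  have "(LBINT s:{0..0::real}. S (0 - s) (g s (f s))) = 0"
    using integral_discrete_difference[of "{0}" lborel "\<lambda>s. indicator {0..0::real} s *\<^sub>R S (0 - s) (g s (f s))" "\<lambda>_. 0"]
    by (auto simp: set_lebesgue_integral_def)
  then show "f 0 = x" using f by (simp add: solution_def S_0)
  \<comment> \<open>the unstable component that the Lyapunov--Perron image misses\<close>
  define y where "y = x - lp \<xi> f 0"
  have diff: "f t - lp \<xi> f t = S t y" if "0 \<le> t" for t
    using f(1) lp_eq_flow[OF f(2) that, of \<xi>] that by (simp add: solution_def y_def blinfun.diff_right)
  have Py: "P y = y"
    using P_lp_0[OF f(2) \<xi>] by (simp add: y_def blinfun.diff_right) (simp add: \<xi>_def)
  obtain C C' where C: "0 \<le> C" "\<And>t. 0 \<le> t \<Longrightarrow> norm (f t) \<le> C"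
    "0 \<le> C'" "\<And>t. 0 \<le> t \<Longrightarrow> norm (lp \<xi> f t) \<le> C'"
    using bounded_pathE[OF f(2)] bounded_pathE[OF lp_bounded_path[OF f(2) \<xi>]] by metis
  have "norm y \<le> K * exp (- a * t) * (C + C')" if "0 \<le> t" for t
  proof -
    have "norm y = norm (V t (S t y))" using V_S[OF that, of y] by (simp add: Py)
    also have "\<dots> \<le> K * exp (- a * t) * norm (S t y)" by (rule V_bound[OF that])
    also have "norm (S t y) \<le> C + C'"
      unfolding diff[OF that, symmetric]
      using C(2,4)[OF that] norm_triangle_ineq4[of "f t" "lp \<xi> f t"] by linarith
    finally show ?thesis using K_nonneg by (simp add: mult_left_mono)
  qed
  moreover have "((\<lambda>t. K * exp (- a * t) * (C + C')) \<longlongrightarrow> K * 0 * (C + C')) at_top"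
    by (intro tendsto_intros filterlim_compose[OF exp_at_bot] filterlim_tendsto_neg_mult_at_bot[OF tendsto_const]
        filterlim_ident) (use a_pos in simp)
  ultimately have "norm y \<le> K * 0 * (C + C')"
    by (intro tendsto_lowerbound[where F = at_top]) (auto intro: eventually_at_top_linorderI[of 0])
  then have "y = 0" by simp
  then show "lp (x - P x) f t = f t" if "0 \<le> t"
    using diff[OF that] by (simp add: \<xi>_def)
qed

section \<open>The stable manifold of the deterministic equation\<close>

text \<open>The function whose graph is the set of initial values of bounded solutions, defined
  as a limit of iterates rather than by choice for the sake of measurability.\<close>

definition stable_fibre :: "'a \<Rightarrow> 'a" where
  "stable_fibre \<xi> = lim (\<lambda>n. P (picard \<xi> n 0))"

lemma stable_fibre_eq:
  assumes f: "bounded_path f" "\<And>t. 0 \<le> t \<Longrightarrow> lp \<xi> f t = f t" "P \<xi> = 0"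
  shows "(\<lambda>n. P (picard \<xi> n 0)) \<longlonglongrightarrow> P (f 0)" and "stable_fibre \<xi> = P (f 0)" and "f 0 = \<xi> + stable_fibre \<xi>"
proof -
  show "(\<lambda>n. P (picard \<xi> n 0)) \<longlonglongrightarrow> P (f 0)"
    by (intro tendsto_intros picard_limit[OF f] order_refl)
  then show "stable_fibre \<xi> = P (f 0)"
    unfolding stable_fibre_def by (rule limI)
  then show "f 0 = \<xi> + stable_fibre \<xi>"
    using P_lp_0[OF f(1,3)] f(2)[of 0] by simp
qed

lemma stable_fibre_range: assumes "P \<xi> = 0" shows "stable_fibre \<xi> \<in> range P"
proof (rule lp_fixed_point[OF assms])
  fix f assume "bounded_path f" "\<And>t. 0 \<le> t \<Longrightarrow> lp \<xi> f t = f t"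
  from stable_fibre_eq(2)[OF this assms] show ?thesis by simp
qed

lemma stable_fibre_limit:
  assumes "P \<xi> = 0" shows "(\<lambda>n. P (picard \<xi> n 0)) \<longlonglongrightarrow> stable_fibre \<xi>"
proof (rule lp_fixed_point[OF assms])
  fix f assume "bounded_path f" "\<And>t. 0 \<le> t \<Longrightarrow> lp \<xi> f t = f t"
  from stable_fibre_eq(1,2)[OF this assms] show ?thesis by simp
qed

lemma stable_fibre_lipschitz:
  "(norm P * K / (1 - contraction_const))-lipschitz_on {\<xi>. P \<xi> = 0} stable_fibre"
proof (rule lipschitz_onI)
  fix \<xi> \<zeta> assume *: "\<xi> \<in> {\<xi>. P \<xi> = 0}" "\<zeta> \<in> {\<xi>. P \<xi> = 0}"
  obtain f where f: "bounded_path f" "\<And>t. 0 \<le> t \<Longrightarrow> lp \<xi> f t = f t"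
    using * lp_fixed_point[of \<xi>] by blast
  obtain h where h: "bounded_path h" "\<And>t. 0 \<le> t \<Longrightarrow> lp \<zeta> h t = h t"
    using * lp_fixed_point[of \<zeta>] by blast
  have "dist (stable_fibre \<xi>) (stable_fibre \<zeta>) = norm (P (f 0 - h 0))"
    using stable_fibre_eq(2)[OF f] stable_fibre_eq(2)[OF h] *
    by (simp add: dist_norm blinfun.diff_right)
  also have "\<dots> \<le> norm P * norm (f 0 - h 0)" by (rule norm_blinfun)
  also have "\<dots> \<le> norm P * (K * norm (\<xi> - \<zeta>) / (1 - contraction_const))"
    using lp_fixed_points_dist[OF f _ h, of 0] * by (intro mult_left_mono) auto
  finally show "dist (stable_fibre \<xi>) (stable_fibre \<zeta>) \<le> norm P * K / (1 - contraction_const) * dist \<xi> \<zeta>"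
    by (simp add: dist_norm)
qed (use K_nonneg contraction_const in auto)

text \<open>The stable manifold of the deterministic equation: both sides say that \<open>x\<close> is the value at
  time 0 of the fixed point with parameter \<open>x - P x\<close>.\<close>

lemma bounded_solution_iff:
  "(\<exists>f. bounded_path f \<and> solution x f) \<longleftrightarrow> x = (x - P x) + stable_fibre (x - P x)"
proof -
  have \<xi>: "P (x - P x) = 0" by (simp add: blinfun.diff_right P_idem)
  show ?thesis
  proof
    assume "\<exists>f. bounded_path f \<and> solution x f"
    then obtain f where f: "bounded_path f" "solution x f" by blast
    note solution_lp_fixed_point[OF f(2,1)]
    with stable_fibre_eq(3)[OF f(1) _ \<xi>] show "x = (x - P x) + stable_fibre (x - P x)" by simp
  next
    assume x: "x = (x - P x) + stable_fibre (x - P x)"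
    obtain f where f: "bounded_path f" "\<And>t. 0 \<le> t \<Longrightarrow> lp (x - P x) f t = f t"
      using lp_fixed_point[OF \<xi>] by blast
    then have "f 0 = x" using x stable_fibre_eq(3)[OF f \<xi>] by simp
    with f lp_fixed_point_solution[OF f] show "\<exists>f. bounded_path f \<and> solution x f" by auto
  qed
qed

end

section \<open>From the dichotomy to a hyperbolic semigroup\<close>

text \<open>The inverse of \<open>S t\<close> on the range of \<open>P\<close> is linear because \<open>S t\<close> is injective there, and
  bounded by the dichotomy estimate, so it extends along \<open>P\<close> to a bounded operator on the whole space.
  A nonzero vector serves to derive \<open>0 \<le> K\<close> from that estimate.\<close>

lemma exponential_dichotomy_hyperbolic:
  fixes S :: "real \<Rightarrow> 'h::{banach, second_countable_topology} \<Rightarrow>\<^sub>L 'h" and x0 :: 'h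
  assumes S: "C0_semigroup S" and D: "exponential_dichotomy S P \<alpha> \<beta> K" and x0: "x0 \<noteq> 0"
  obtains V where "hyperbolic_semigroup S V P \<alpha> (- \<beta>) K"
proof -
  define W where "W r = inv_into (range P) (S r)" for r
  have P_idem: "P (P x) = P x" for x
    using D unfolding exponential_dichotomy_def by (metis blinfun_apply_blinfun_compose)
  have P_S: "P (S t x) = S t (P x)" if "0 \<le> t" for t x
    using D that unfolding exponential_dichotomy_def by (metis blinfun_apply_blinfun_compose)
  have hom: "homeomorphism (range P) (range P) (S t) (W t)" if "0 \<le> t" for t
    using D that by (simp add: exponential_dichotomy_def W_def)
  have W_S: "W t (S t (P x)) = P x" and S_W: "S t (W t (P x)) = P x" and W_range: "W t (P x) \<in> range P"
    if "0 \<le> t" for t x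
    using hom[OF that] by (auto simp: homeomorphism_def)
  have P_W: "P (W t (P x)) = W t (P x)" if "0 \<le> t" for t x
    using W_range[OF that, of x] P_idem by auto
  have W_eq: "W t (P x) = y" if "0 \<le> t" "P y = y" "S t y = P x" for t x y
    using W_S[OF that(1), of y] that by simp
  have W_bound: "norm (W t (P x)) \<le> K * exp (- \<alpha> * t) * norm x" if "0 \<le> t" for t x
  proof -
    have "W t (P x) = two_sided S P (- t) (P x)"
    proof (cases "t = 0")
      case True
      then show ?thesis using S W_S[of 0 x] by (simp add: two_sided_def C0_semigroup_def)
    qed (use that in \<open>simp add: two_sided_def W_def\<close>)
    moreover have "\<forall>t\<le>0. \<forall>x. norm (two_sided S P t (P x)) \<le> K * exp (\<alpha> * t) * norm x"
      using D unfolding exponential_dichotomy_def by blast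
    ultimately show ?thesis using that by (metis minus_mult_commute neg_le_0_iff_le)
  qed
  have lin: "bounded_linear (\<lambda>x. W t (P x))" if "0 \<le> t" for t
  proof (rule bounded_linear_intro[where K = "K * exp (- \<alpha> * t)"])
    show "W t (P (x + y)) = W t (P x) + W t (P y)" for x y
      by (rule W_eq) (use that in \<open>simp_all add: blinfun.add_right P_W S_W\<close>)
    show "W t (P (c *\<^sub>R x)) = c *\<^sub>R W t (P x)" for c x
      by (rule W_eq) (use that in \<open>simp_all add: blinfun.scaleR_right P_W S_W\<close>)
    show "norm (W t (P x)) \<le> norm x * (K * exp (- \<alpha> * t))" for x
      using W_bound[OF that, of x] by (simp add: mult.commute)
  qed
  define V where "V t = Blinfun (\<lambda>x. W t (P x))" for t
  have V: "V t x = W t (P x)" if "0 \<le> t" for t x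
    unfolding V_def using lin[OF that] by (simp add: bounded_linear_Blinfun_apply)
  have "0 \<le> K * norm x0"
    using W_bound[of 0 x0] norm_ge_zero[of "W 0 (P x0)"] by (simp del: norm_ge_zero)
  then have K: "0 \<le> K" using x0 by (simp add: zero_le_mult_iff)
  have "norm (S t (x - P x)) \<le> K * exp (\<beta> * t) * norm x" if "0 \<le> t" for t x
    using D that by (simp add: exponential_dichotomy_def compl_proj_def blinfun.diff_left)
  then have "hyperbolic_semigroup S V P \<alpha> (- \<beta>) K"
    by unfold_locales (simp_all add: S P_idem P_S V P_W W_S S_W W_bound[simplified] K)
  then show thesis by (rule that)
qed

text \<open>Multiplying all orbits by \<open>exp (- c t)\<close> shifts both growth exponents by \<open>- c\<close>. With \<open>c = \<eta>\<close>
  strictly between the exponents, the weighted growth condition becomes plain boundedness.\<close>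

lemma hyperbolic_semigroup_rescale:
  fixes c :: real
  assumes "hyperbolic_semigroup S V P a b K"
  shows "hyperbolic_semigroup (\<lambda>t. exp (- c * t) *\<^sub>R S t) (\<lambda>t. exp (c * t) *\<^sub>R V t) P (a - c) (b + c) K"
proof -
  interpret hyperbolic_semigroup S V P a b K by fact
  have inv: "exp (c * t) * exp (- c * t) = 1" "exp (- c * t) * exp (c * t) = 1" for t
    by (simp_all add: exp_minus)
  show ?thesis
  proof
    show "C0_semigroup (\<lambda>t. exp (- c * t) *\<^sub>R S t)"
      unfolding C0_semigroup_def
      by (auto simp: S_0 S_add blinfun.scaleR_left blinfun.scaleR_right exp_add[symmetric] algebra_simps
          intro!: blinfun_eqI continuous_intros S_cont)
    show "P (P x) = P x" for x by (rule P_idem)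
    show "0 \<le> K" by (rule K_nonneg)
  next
    fix t :: real and x assume t: "0 \<le> t"
    show "P ((exp (- c * t) *\<^sub>R S t) x) = (exp (- c * t) *\<^sub>R S t) (P x)"
      by (simp only: blinfun.scaleR_left blinfun.scaleR_right P_S[OF t])
    show "P ((exp (c * t) *\<^sub>R V t) x) = (exp (c * t) *\<^sub>R V t) x"
      by (simp only: blinfun.scaleR_left blinfun.scaleR_right P_V[OF t])
    show "(exp (c * t) *\<^sub>R V t) ((exp (- c * t) *\<^sub>R S t) (P x)) = P x"
      by (simp only: blinfun.scaleR_left blinfun.scaleR_right V_S[OF t] scaleR_scaleR inv scaleR_one)
    show "(exp (- c * t) *\<^sub>R S t) ((exp (c * t) *\<^sub>R V t) x) = P x"
      by (simp only: blinfun.scaleR_left blinfun.scaleR_right S_V[OF t] scaleR_scaleR inv scaleR_one)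
    have "norm ((exp (c * t) *\<^sub>R V t) x) \<le> exp (c * t) * (K * exp (- a * t) * norm x)"
      by (simp only: blinfun.scaleR_left norm_scaleR abs_exp_cancel)
         (intro mult_left_mono V_bound t; simp)
    also have "\<dots> = K * exp (- (a - c) * t) * norm x"
      by (simp add: exp_add[symmetric] algebra_simps)
    finally show "norm ((exp (c * t) *\<^sub>R V t) x) \<le> K * exp (- (a - c) * t) * norm x" .
    have "norm ((exp (- c * t) *\<^sub>R S t) (x - P x)) \<le> exp (- c * t) * (K * exp (- b * t) * norm x)"
      by (simp only: blinfun.scaleR_left norm_scaleR abs_exp_cancel)
         (intro mult_left_mono S_bound t; simp)
    also have "\<dots> = K * exp (- (b + c) * t) * norm x"
      by (simp add: exp_add[symmetric] algebra_simps)
    finally show "norm ((exp (- c * t) *\<^sub>R S t) (x - P x)) \<le> K * exp (- (b + c) * t) * norm x" .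
  qed
qed

section \<open>The noise\<close>

lemma wiener_shift_shift: "wiener_shift s (wiener_shift t \<omega>) = wiener_shift (s + t) \<omega>"
  by (simp add: wiener_shift_def fun_eq_iff add.assoc)

lemma wiener_shift_0: "\<omega> 0 = 0 \<Longrightarrow> wiener_shift 0 \<omega> = \<omega>"
  by (simp add: wiener_shift_def)

lemma space_borel_C0: "space borel_C0 = C0_paths"
  by (simp add: borel_C0_def space_measure_of_conv)

text \<open>Singletons are compact, so the preimages of open sets under an evaluation are subbasic open sets.\<close>

lemma eval_borel_C0: "(\<lambda>\<omega>. \<omega> t) \<in> borel_measurable borel_C0"
proof (rule borel_measurableI)
  fix U :: "real set" assume "open U"
  then have "openin compact_open_topology {\<omega> \<in> C0_paths. \<omega> ` {t} \<subseteq> U}"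
    unfolding compact_open_topology_def
    by (intro topology_generated_by_Basis CollectI exI[of _ "{t}"] exI[of _ U]) simp
  moreover have "{U. openin compact_open_topology U} \<subseteq> Pow C0_paths"
    using openin_subset[of compact_open_topology] by (auto simp: compact_open_topology_def)
  ultimately have "{\<omega> \<in> C0_paths. \<omega> ` {t} \<subseteq> U} \<in> sets borel_C0"
    by (simp add: borel_C0_def)
  then show "(\<lambda>\<omega>. \<omega> t) -` U \<inter> space borel_C0 \<in> sets borel_C0"
    by (simp add: space_borel_C0 Int_def conj_commute)
qed

text \<open>A Caratheodory function is jointly measurable: it is the pointwise limit of its values at
  times rounded down to multiples of \<open>1 / (n + 1)\<close>, which form a countable set.\<close>

lemma measurable_eval_continuous:
  fixes f :: "'a \<Rightarrow> real \<Rightarrow> 'b::metric_space"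
  assumes cont: "\<And>x. x \<in> space M \<Longrightarrow> continuous_on UNIV (f x)"
    and meas: "\<And>t. (\<lambda>x. f x t) \<in> borel_measurable M"
  shows "(\<lambda>(t, x). f x t) \<in> borel_measurable (borel \<Otimes>\<^sub>M M)"
proof (rule borel_measurable_LIMSEQ_metric)
  fix n :: nat
  have [measurable]: "(\<lambda>x. f x t) \<in> borel_measurable M" for t by (rule meas)
  show "(\<lambda>p. f (snd p) (real_of_int \<lfloor>fst p * real (Suc n)\<rfloor> / real (Suc n))) \<in> borel_measurable (borel \<Otimes>\<^sub>M M)"
    by (rule measurable_compose_countable[where f = "\<lambda>i p. f (snd p) (real_of_int i / real (Suc n))"]) measurable
next
  fix p :: "real \<times> 'a" assume p: "p \<in> space (borel \<Otimes>\<^sub>M M)"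
  have "(\<lambda>n. real_of_int \<lfloor>fst p * real (Suc n)\<rfloor> / real (Suc n)) \<longlonglongrightarrow> fst p"
  proof (rule tendsto_sandwich)
    show "\<forall>\<^sub>F n in sequentially. fst p - 1 / real (Suc n) \<le> real_of_int \<lfloor>fst p * real (Suc n)\<rfloor> / real (Suc n)"
    proof (rule always_eventually, rule allI)
      fix n
      have "fst p * real (Suc n) - 1 \<le> real_of_int \<lfloor>fst p * real (Suc n)\<rfloor>" by linarith
      then have "(fst p * real (Suc n) - 1) / real (Suc n) \<le> real_of_int \<lfloor>fst p * real (Suc n)\<rfloor> / real (Suc n)"
        by (rule divide_right_mono) simp
      moreover have "(fst p * real (Suc n) - 1) / real (Suc n) = fst p - 1 / real (Suc n)"
        by (simp add: diff_divide_distrib)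
      ultimately show "fst p - 1 / real (Suc n) \<le> real_of_int \<lfloor>fst p * real (Suc n)\<rfloor> / real (Suc n)" by simp
    qed
    show "\<forall>\<^sub>F n in sequentially. real_of_int \<lfloor>fst p * real (Suc n)\<rfloor> / real (Suc n) \<le> fst p"
      by (intro always_eventually allI) (simp add: divide_le_eq del: of_nat_Suc)
    have "(\<lambda>n. fst p - 1 / real (Suc n)) \<longlonglongrightarrow> fst p - 0"
      by (intro tendsto_intros LIMSEQ_inverse_real_of_nat[unfolded inverse_eq_divide])
    then show "(\<lambda>n. fst p - 1 / real (Suc n)) \<longlonglongrightarrow> fst p" by simp
  qed simp
  then have "(\<lambda>n. f (snd p) (real_of_int \<lfloor>fst p * real (Suc n)\<rfloor> / real (Suc n))) \<longlonglongrightarrow> f (snd p) (fst p)"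
    by (rule isCont_tendsto_compose[rotated])
       (use cont[of "snd p"] p in \<open>auto simp: space_pair_measure continuous_on_eq_continuous_at\<close>)
  then show "(\<lambda>n. f (snd p) (real_of_int \<lfloor>fst p * real (Suc n)\<rfloor> / real (Suc n))) \<longlonglongrightarrow>
      (case p of (t, x) \<Rightarrow> f x t)"
    by (simp only: case_prod_unfold)
qed

locale ou_noise =
  fixes W :: "(real \<Rightarrow> real) measure" and \<Omega> :: "(real \<Rightarrow> real) set"
  assumes sets_W: "sets W = sets borel_C0"
    and noise: "noise_set W \<Omega>"
begin

abbreviation M :: "(real \<Rightarrow> real) measure" where
  "M \<equiv> restrict_space W \<Omega>"

lemma \<Omega>_sets: "\<Omega> \<in> sets W"
  using noise by (simp add: noise_set_def)

lemma space_M: "space M = \<Omega>"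
  by (simp add: \<Omega>_sets)

lemma \<Omega>_paths: assumes "\<omega> \<in> \<Omega>" shows "continuous_on UNIV \<omega>" "\<omega> 0 = 0"
proof -
  have "\<Omega> \<subseteq> C0_paths"
    using sets.sets_into_space[OF \<Omega>_sets] sets_eq_imp_space_eq[OF sets_W] by (simp add: space_borel_C0)
  then show "continuous_on UNIV \<omega>" "\<omega> 0 = 0" using assms by (auto simp: C0_paths_def)
qed

lemma shift_0 [simp]: "\<omega> \<in> \<Omega> \<Longrightarrow> wiener_shift 0 \<omega> = \<omega>"
  by (simp add: wiener_shift_0 \<Omega>_paths)

lemma shift_in: "\<omega> \<in> \<Omega> \<Longrightarrow> wiener_shift t \<omega> \<in> \<Omega>"
proof -
  assume "\<omega> \<in> \<Omega>"
  then have "wiener_shift t \<omega> \<in> wiener_shift t ` \<Omega>" by (rule imageI)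
  also have "wiener_shift t ` \<Omega> = \<Omega>" using noise by (simp only: noise_set_def)
  finally show ?thesis .
qed

lemma \<Omega>_nonempty: "\<Omega> \<noteq> {}"
proof
  assume "\<Omega> = {}"
  then have "emeasure W {} = 1" using noise by (simp add: noise_set_def)
  then show False by simp
qed

lemma z_cont: "\<omega> \<in> \<Omega> \<Longrightarrow> continuous_on UNIV (\<lambda>t. zOU (wiener_shift t \<omega>))"
  using noise unfolding noise_set_def by (elim conjE) (drule bspec, assumption, elim conjE)

lemma eval_measurable: "(\<lambda>\<omega>. \<omega> t) \<in> borel_measurable M"
  using eval_borel_C0 by (intro measurable_restrict_space1) (simp only: measurable_cong_sets[OF sets_W refl])

lemma path_measurable: "(\<lambda>(t, \<omega>). \<omega> t) \<in> borel_measurable (borel \<Otimes>\<^sub>M M)"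
proof (rule measurable_eval_continuous)
  show "continuous_on UNIV \<omega>" if "\<omega> \<in> space M" for \<omega>
    using that by (intro \<Omega>_paths) (simp only: space_M)
qed (rule eval_measurable)

lemma borel_measurable_path:
  assumes "f \<in> borel_measurable N" "h \<in> N \<rightarrow>\<^sub>M M"
  shows "(\<lambda>x. h x (f x)) \<in> borel_measurable N"
  using measurable_compose[OF measurable_Pair[OF assms] path_measurable] by simp

text \<open>The value of \<^const>\<open>zOU\<close> at a shifted path is an integral over a parameter of path values, so
  its joint measurability comes from that of the evaluation of paths.\<close>

lemma z_shift_measurable: "(\<lambda>(t, \<omega>). zOU (wiener_shift t \<omega>)) \<in> borel_measurable (borel \<Otimes>\<^sub>M M)"
proof -
  have [measurable]: "(\<lambda>q. snd (fst q) (snd q + fst (fst q))) \<in> borel_measurable ((borel \<Otimes>\<^sub>M M) \<Otimes>\<^sub>M lborel)"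
    by (rule borel_measurable_path) measurable
  have [measurable]: "(\<lambda>q. snd (fst q) (fst (fst q))) \<in> borel_measurable ((borel \<Otimes>\<^sub>M M) \<Otimes>\<^sub>M lborel)"
    by (rule borel_measurable_path) measurable
  have "(\<lambda>p. - (\<integral>\<tau>. indicator {..0} \<tau> *\<^sub>R (exp \<tau> * (snd p (\<tau> + fst p) - snd p (fst p))) \<partial>lborel))
      \<in> borel_measurable (borel \<Otimes>\<^sub>M M)"
    by measurable
  then show ?thesis
    by (simp add: zOU_def wiener_shift_def set_lebesgue_integral_def case_prod_unfold)
qed

lemma borel_measurable_z_shift [measurable (raw)]:
  assumes "f \<in> borel_measurable N" "h \<in> N \<rightarrow>\<^sub>M M"
  shows "(\<lambda>x. zOU (wiener_shift (f x) (h x))) \<in> borel_measurable N"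
  using measurable_compose[OF measurable_Pair[OF assms] z_shift_measurable] by simp

lemma z_measurable: "zOU \<in> borel_measurable M"
proof -
  have "(\<lambda>\<omega>. zOU (wiener_shift 0 \<omega>)) \<in> borel_measurable M" by measurable
  then show ?thesis by (rule measurable_cong[THEN iffD1, rotated]) (simp add: space_M)
qed

lemma zint_Icc: "s \<le> t \<Longrightarrow> zOU_int \<omega> s t = (LBINT \<tau>:{s..t}. zOU (wiener_shift \<tau> \<omega>))"
  by (simp add: zOU_int_def interval_integral_Icc)

lemma zint_add: assumes "\<omega> \<in> \<Omega>" shows "zOU_int \<omega> r s + zOU_int \<omega> s t = zOU_int \<omega> r t"
proof -
  have "interval_lebesgue_integrable lborel (ereal (min r (min s t))) (ereal (max r (max s t)))
      (\<lambda>\<tau>. zOU (wiener_shift \<tau> \<omega>))"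
    by (intro interval_integrable_continuous_on continuous_on_subset[OF z_cont[OF assms]]) auto
  then show ?thesis
    unfolding zOU_int_def by (intro interval_integral_sum) (simp flip: ereal_min ereal_max)
qed

lemma zint_shift: assumes "0 \<le> s" shows "zOU_int (wiener_shift t \<omega>) 0 s = zOU_int \<omega> t (t + s)"
proof -
  have "zOU_int \<omega> t (t + s) = (\<integral>\<tau>. indicator {t..t + s} \<tau> *\<^sub>R zOU (wiener_shift \<tau> \<omega>) \<partial>lborel)"
    using assms by (simp add: zint_Icc set_lebesgue_integral_def)
  also have "\<dots> = (\<integral>\<tau>. indicator {t..t + s} (t + 1 * \<tau>) *\<^sub>R zOU (wiener_shift (t + 1 * \<tau>) \<omega>) \<partial>lborel)"
    by (subst lborel_integral_real_affine[where c = 1 and t = t]) simp_all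
  also have "\<dots> = (\<integral>\<tau>. indicator {0..s} \<tau> *\<^sub>R zOU (wiener_shift \<tau> (wiener_shift t \<omega>)) \<partial>lborel)"
    by (intro Bochner_Integration.integral_cong) (auto simp: indicator_def wiener_shift_shift add.commute)
  finally show ?thesis using assms by (simp add: zint_Icc set_lebesgue_integral_def)
qed

lemma zint_cont: assumes "\<omega> \<in> \<Omega>" shows "continuous_on {0..} (zOU_int \<omega> 0)"
proof (rule continuous_on_atLeastI)
  fix T :: real
  let ?z = "\<lambda>\<tau>. zOU (wiener_shift \<tau> \<omega>)"
  have c: "continuous_on A ?z" for A using z_cont[OF assms] continuous_on_subset by blast
  have "continuous_on {0..T} (\<lambda>t. integral {0..t} ?z)"
    by (intro indefinite_integral_continuous_1 integrable_continuous_interval c)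
  then show "continuous_on {0..T} (zOU_int \<omega> 0)"
  proof (rule continuous_on_eq)
    fix t assume "t \<in> {0..T}"
    then show "integral {0..t} ?z = zOU_int \<omega> 0 t"
      unfolding zOU_int_def
      by (intro interval_integral_eq_integral[symmetric] borel_integrable_atLeastAtMost' c) simp
  qed
qed

lemma borel_measurable_zint:
  "(\<lambda>(t, \<omega>). zOU_int \<omega> 0 (max 0 t)) \<in> borel_measurable (borel \<Otimes>\<^sub>M M)"
proof -
  have "(\<lambda>p. \<integral>\<tau>. (if 0 \<le> \<tau> \<and> \<tau> \<le> max 0 (fst p) then 1 else 0) *\<^sub>R zOU (wiener_shift \<tau> (snd p)) \<partial>lborel)
      \<in> borel_measurable (borel \<Otimes>\<^sub>M M)"
    by measurable
  then show ?thesis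
    by (simp add: zint_Icc set_lebesgue_integral_def case_prod_unfold indicator_def)
qed

end

section \<open>Random sets and the conjugated dynamical system\<close>

text \<open>The distance to a set that is the image of a separable space under a continuous map is an
  infimum over a countable dense set of parameters, by continuity, hence a countable infimum of
  measurable functions.\<close>

lemma borel_measurable_dist_parametrized_set:
  fixes m :: "'w \<Rightarrow> 'h::{real_normed_vector, second_countable_topology} \<Rightarrow> 'h"
  assumes cont: "\<And>\<omega>. \<omega> \<in> space M \<Longrightarrow> continuous_on UNIV (m \<omega>)"
    and meas: "\<And>y. (\<lambda>\<omega>. m \<omega> y) \<in> borel_measurable M"
  shows "(\<lambda>\<omega>. INF y\<in>range (m \<omega>). norm (x - y)) \<in> borel_measurable M"
proof -
  obtain D :: "'h set" where D: "countable D" "\<And>U. open U \<Longrightarrow> U \<noteq> {} \<Longrightarrow> \<exists>d\<in>D. d \<in> U"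
    by (rule countable_dense_setE) blast
  have [simp]: "D \<noteq> {}" using D(2)[of UNIV] by blast
  have bdd: "bdd_below ((\<lambda>y. norm (x - m \<omega> y)) ` A)" for \<omega> A
    by (rule bdd_belowI2[of _ 0]) simp
  have "(\<lambda>\<omega>. INF d\<in>D. norm (x - m \<omega> d)) \<in> borel_measurable M"
    using meas by (intro borel_measurable_cINF D(1) bdd) simp_all
  moreover have "(INF d\<in>D. norm (x - m \<omega> d)) = (INF y\<in>range (m \<omega>). norm (x - y))" if "\<omega> \<in> space M" for \<omega>
  proof (rule antisym)
    show "(INF d\<in>D. norm (x - m \<omega> d)) \<le> (INF y\<in>range (m \<omega>). norm (x - y))"
    proof (rule cINF_greatest)
      fix z assume "z \<in> range (m \<omega>)"
      then obtain y where z: "z = m \<omega> y" by blast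
      show "(INF d\<in>D. norm (x - m \<omega> d)) \<le> norm (x - z)"
      proof (rule field_le_epsilon)
        fix e :: real assume "0 < e"
        have "continuous_on UNIV (\<lambda>y. norm (x - m \<omega> y))"
          by (intro continuous_intros cont that)
        then have "open ((\<lambda>y. norm (x - m \<omega> y)) -` {..<norm (x - z) + e})"
          by (intro open_vimage) auto
        moreover have "y \<in> (\<lambda>y. norm (x - m \<omega> y)) -` {..<norm (x - z) + e}"
          using \<open>0 < e\<close> z by simp
        ultimately obtain d where d: "d \<in> D" "norm (x - m \<omega> d) < norm (x - z) + e"
          using D(2) by blast
        have "(INF d\<in>D. norm (x - m \<omega> d)) \<le> norm (x - m \<omega> d)"
          by (rule cINF_lower[OF bdd d(1)])
        with d(2) show "(INF d\<in>D. norm (x - m \<omega> d)) \<le> norm (x - z) + e" by simp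
      qed
    qed simp
    have "(INF y. norm (x - m \<omega> y)) \<le> (INF d\<in>D. norm (x - m \<omega> d))"
      by (rule cINF_superset_mono) (auto intro: bdd)
    then show "(INF y\<in>range (m \<omega>). norm (x - y)) \<le> (INF d\<in>D. norm (x - m \<omega> d))"
      by (simp add: image_comp o_def)
  qed
  ultimately show ?thesis
    by (rule measurable_cong[THEN iffD1, rotated])
qed

context ou_noise
begin

text \<open>The transformation \<open>T\<close> conjugates the two cocycles: the factors at the intermediate time cancel.\<close>

lemma random_dynamical_system_spde_rds:
  fixes u :: "real \<Rightarrow> (real \<Rightarrow> real) \<Rightarrow> 'h::{real_normed_vector, second_countable_topology} \<Rightarrow> 'h"
  assumes u: "random_dynamical_system M u"
  shows "random_dynamical_system M (spde_rds u)"
  unfolding random_dynamical_system_def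
proof (intro conjI ballI allI impI)
  let ?N = "restrict_space borel {0..} \<Otimes>\<^sub>M (M \<Otimes>\<^sub>M (borel :: 'h measure))"
  have u_meas: "(\<lambda>(t, \<omega>, x). u t \<omega> x) \<in> borel_measurable ?N"
    using u by (simp add: random_dynamical_system_def)
  have [measurable]: "zOU \<in> borel_measurable M" by (rule z_measurable)
  have t: "fst \<in> borel_measurable ?N"
    by (rule measurable_compose[OF measurable_fst]) (simp add: measurable_restrict_space1)
  have z: "(\<lambda>q. zOU (wiener_shift (fst q) (fst (snd q)))) \<in> borel_measurable ?N"
    by (rule borel_measurable_z_shift[OF t]) measurable
  have "(\<lambda>q. (fst q, fst (snd q), exp (- zOU (fst (snd q))) *\<^sub>R snd (snd q))) \<in> ?N \<rightarrow>\<^sub>M ?N"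
    by measurable
  from measurable_compose[OF this u_meas]
  have "(\<lambda>q. u (fst q) (fst (snd q)) (exp (- zOU (fst (snd q))) *\<^sub>R snd (snd q))) \<in> borel_measurable ?N"
    by simp
  with z have "(\<lambda>q. exp (zOU (wiener_shift (fst q) (fst (snd q)))) *\<^sub>R
      u (fst q) (fst (snd q)) (exp (- zOU (fst (snd q))) *\<^sub>R snd (snd q))) \<in> borel_measurable ?N"
    by (intro borel_measurable_scaleR borel_measurable_exp[THEN measurable_compose[rotated]]) simp_all
  then show "(\<lambda>(t, \<omega>, x). spde_rds u t \<omega> x) \<in> borel_measurable ?N"
    by (simp add: spde_rds_def T_inv_def T_map_def case_prod_unfold)
next
  fix \<omega> x assume "\<omega> \<in> space M"
  then show "spde_rds u 0 \<omega> x = x"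
    using u by (simp add: random_dynamical_system_def spde_rds_def T_inv_def T_map_def space_M
        exp_minus)
next
  fix s t :: real and \<omega> x assume "0 \<le> s" "0 \<le> t" "\<omega> \<in> space M"
  then have "u (s + t) \<omega> y = u t (wiener_shift s \<omega>) (u s \<omega> y)" for y
    using u by (simp add: random_dynamical_system_def)
  then show "spde_rds u (s + t) \<omega> x = spde_rds u t (wiener_shift s \<omega>) (spde_rds u s \<omega> x)"
    by (simp add: spde_rds_def T_inv_def T_map_def exp_minus wiener_shift_shift add.commute)
qed

end

section \<open>Removing the weight from the random equation\<close>

text \<open>Here \<open>S\<close> is the semigroup already multiplied by \<open>exp (- \<eta> t)\<close>; the semigroup of the random
  equation is \<open>exp (\<eta> t) S t\<close>.\<close>

locale noisy_equation = ou_noise W \<Omega> + gapped_semigroup S V P a b K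
  for W :: "(real \<Rightarrow> real) measure" and \<Omega>
    and S V :: "real \<Rightarrow> 'h::{banach, second_countable_topology} \<Rightarrow>\<^sub>L 'h" and P a b K +
  fixes F :: "'h \<Rightarrow> 'h" and L \<eta> :: real
  assumes F_0: "F 0 = 0"
    and F_lip: "proj_lipschitz P L F"
    and L_nonneg: "0 \<le> L"
    and gap: "K * L * (1 / b + 1 / a) < 1"
begin

text \<open>The weight of \<^const>\<open>C_eta_plus\<close> is the exponential of minus this function. Dividing a mild
  solution by the exponential of this function removes both the exponential growth rate and the linear random term.\<close>

definition weight :: "(real \<Rightarrow> real) \<Rightarrow> real \<Rightarrow> real" where
  "weight \<omega> t = \<eta> * t + zOU_int \<omega> 0 t"

text \<open>The nonlinearity \<open>G\<close> is itself a conjugate of \<open>F\<close> by \<open>exp z\<close>, so after removal of the weight it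
  remains a conjugate of \<open>F\<close>, by the exponential of the sum.\<close>

definition total_weight :: "(real \<Rightarrow> real) \<Rightarrow> real \<Rightarrow> real" where
  "total_weight \<omega> t = weight \<omega> t + zOU (wiener_shift t \<omega>)"

definition G_rescaled :: "(real \<Rightarrow> real) \<Rightarrow> real \<Rightarrow> 'h \<Rightarrow> 'h" where
  "G_rescaled \<omega> s x = exp (- total_weight \<omega> s) *\<^sub>R F (exp (total_weight \<omega> s) *\<^sub>R x)"

lemma F_cont: "continuous_on UNIV F"
proof -
  have "norm (F x - F y) \<le> 2 * L * norm (x - y)" for x y
  proof -
    have "norm (F x - F y) = norm (P (F x - F y) + compl_proj P (F x - F y))"
      by (simp add: compl_proj_def blinfun.diff_left)
    also have "\<dots> \<le> norm (P (F x - F y)) + norm (compl_proj P (F x - F y))" by (rule norm_triangle_ineq)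
    also have "\<dots> \<le> L * norm (x - y) + L * norm (x - y)"
      using F_lip unfolding proj_lipschitz_def by (intro add_mono) blast+
    finally show ?thesis by simp
  qed
  then have "(2 * L)-lipschitz_on UNIV F"
    using L_nonneg by (intro lipschitz_onI) (auto simp: dist_norm)
  then show ?thesis by (rule lipschitz_on_continuous_on)
qed

lemma F_measurable: "F \<in> borel_measurable borel"
  using F_cont by (rule borel_measurable_continuous_onI)

lemma weight_cont: "\<omega> \<in> \<Omega> \<Longrightarrow> continuous_on {0..} (weight \<omega>)"
  unfolding weight_def[abs_def] by (intro continuous_intros zint_cont)

lemma continuous_on_weight_iff:
  fixes v :: "real \<Rightarrow> 'h"
  assumes "\<omega> \<in> \<Omega>"
  shows "continuous_on {0..} (\<lambda>t. exp (- weight \<omega> t) *\<^sub>R v t) \<longleftrightarrow> continuous_on {0..} v"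
proof
  assume "continuous_on {0..} (\<lambda>t. exp (- weight \<omega> t) *\<^sub>R v t)"
  from continuous_on_scaleR[OF continuous_on_exp[OF weight_cont[OF assms]] this]
  show "continuous_on {0..} v" by (simp add: exp_minus)
next
  assume "continuous_on {0..} v"
  from continuous_on_scaleR[OF continuous_on_exp[OF continuous_on_minus[OF weight_cont[OF assms]]] this]
  show "continuous_on {0..} (\<lambda>t. exp (- weight \<omega> t) *\<^sub>R v t)" .
qed

lemma total_weight_cont: "\<omega> \<in> \<Omega> \<Longrightarrow> continuous_on {0..} (total_weight \<omega>)"
  unfolding total_weight_def[abs_def]
  by (intro continuous_on_add weight_cont continuous_on_subset[OF z_cont]) auto

text \<open>Conjugation by a positive scalar preserves Lipschitz constants, so the gap condition is the same
  for every time and every realisation of the noise.\<close>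

lemma lyapunov_perron_rescaled:
  assumes \<omega>: "\<omega> \<in> \<Omega>"
  shows "lyapunov_perron S V P a b K (G_rescaled \<omega>) L"
proof
  have w: "continuous_on ({0..} \<times> UNIV) (\<lambda>p::real \<times> 'h. total_weight \<omega> (fst p))"
    by (rule continuous_on_compose2[OF total_weight_cont[OF \<omega>]]) (auto intro!: continuous_intros)
  have "continuous_on ({0..} \<times> UNIV) (\<lambda>p. F (exp (total_weight \<omega> (fst p)) *\<^sub>R snd p))"
    by (rule continuous_on_compose2[OF F_cont]) (auto intro!: continuous_on_scaleR continuous_on_exp continuous_on_snd w)
  then show "continuous_on ({0..} \<times> UNIV) (\<lambda>(s, x). G_rescaled \<omega> s x)"
    unfolding G_rescaled_def case_prod_unfold
    by (intro continuous_on_scaleR continuous_on_exp continuous_on_minus w)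
  show "G_rescaled \<omega> s 0 = 0" for s by (simp add: G_rescaled_def F_0)
  show "proj_lipschitz P L (G_rescaled \<omega> s)" for s
    unfolding proj_lipschitz_def
  proof (intro allI)
    fix x y
    let ?e = "exp (total_weight \<omega> s)"
    have "G_rescaled \<omega> s x - G_rescaled \<omega> s y = exp (- total_weight \<omega> s) *\<^sub>R (F (?e *\<^sub>R x) - F (?e *\<^sub>R y))"
      by (simp add: G_rescaled_def scaleR_diff_right)
    then have *: "norm (Q (G_rescaled \<omega> s x - G_rescaled \<omega> s y)) = norm (Q (F (?e *\<^sub>R x) - F (?e *\<^sub>R y))) / ?e" for Q :: "'h \<Rightarrow>\<^sub>L 'h"
      by (simp add: blinfun.scaleR_right exp_minus divide_inverse mult.commute)
    have n: "L * norm (?e *\<^sub>R x - ?e *\<^sub>R y) = L * norm (x - y) * ?e"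
      by (simp add: scaleR_diff_right[symmetric])
    have "norm (P (F (?e *\<^sub>R x) - F (?e *\<^sub>R y))) \<le> L * norm (x - y) * ?e"
      "norm (compl_proj P (F (?e *\<^sub>R x) - F (?e *\<^sub>R y))) \<le> L * norm (x - y) * ?e"
      using F_lip unfolding proj_lipschitz_def n[symmetric] by blast+
    then show "norm (P (G_rescaled \<omega> s x - G_rescaled \<omega> s y)) \<le> L * norm (x - y) \<and>
        norm (compl_proj P (G_rescaled \<omega> s x - G_rescaled \<omega> s y)) \<le> L * norm (x - y)"
      unfolding * by (simp add: divide_le_eq)
  qed
qed (fact L_nonneg gap)+

abbreviation fibre :: "(real \<Rightarrow> real) \<Rightarrow> 'h \<Rightarrow> 'h" where
  "fibre \<omega> \<equiv> lyapunov_perron.stable_fibre S V P (G_rescaled \<omega>)"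

abbreviation iterate :: "(real \<Rightarrow> real) \<Rightarrow> 'h \<Rightarrow> nat \<Rightarrow> real \<Rightarrow> 'h" where
  "iterate \<omega> \<equiv> lyapunov_perron.picard S V P (G_rescaled \<omega>)"

text \<open>The iterates are obtained by composition and by integration over a parameter, both
  of which preserve joint measurability in time and noise.\<close>

lemma iterate_measurable:
  "(\<lambda>(t, \<omega>). iterate \<omega> \<xi> n (max 0 t)) \<in> borel_measurable (borel \<Otimes>\<^sub>M M)"
proof (induction n)
  case 0
  have "(\<lambda>(t, \<omega>). 0 :: 'h) \<in> borel_measurable (borel \<Otimes>\<^sub>M M)" by simp
  then show ?case
    by (rule measurable_cong[THEN iffD1, rotated])
       (auto simp: space_pair_measure space_M lyapunov_perron.picard_def[OF lyapunov_perron_rescaled])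
next
  case (Suc n)
  let ?N = "(borel \<Otimes>\<^sub>M M) \<Otimes>\<^sub>M lborel :: ((real \<times> (real \<Rightarrow> real)) \<times> real) measure"
  note F_measurable [measurable]
  define s where "s q = max 0 (fst (fst q)) - snd q" for q :: "(real \<times> (real \<Rightarrow> real)) \<times> real"
  have s [measurable]: "s \<in> borel_measurable ?N"
    unfolding s_def by measurable
  define h where "h q = \<eta> * s q + zOU_int (snd (fst q)) 0 (max 0 (s q)) + zOU (wiener_shift (s q) (snd (fst q)))"
    for q :: "(real \<times> (real \<Rightarrow> real)) \<times> real"
  have [measurable]: "(\<lambda>q. zOU_int (snd (fst q)) 0 (max 0 (s q))) \<in> borel_measurable ?N"
    using measurable_compose[of "\<lambda>q. (s q, snd (fst q))" ?N, OF _ borel_measurable_zint] by simp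
  have [measurable]: "h \<in> borel_measurable ?N"
    unfolding h_def by measurable
  define f where "f q = iterate (snd (fst q)) \<xi> n (max 0 (s q))" for q
  have [measurable]: "f \<in> borel_measurable ?N"
    using measurable_compose[of "\<lambda>q. (s q, snd (fst q))" ?N, OF _ Suc] unfolding f_def by simp
  have S_cont': "continuous_on UNIV (\<lambda>t. S (max 0 t) \<xi>)"
    by (rule continuous_on_compose2[OF S_cont]) (auto intro!: continuous_intros)
  have [measurable]: "(\<lambda>t. S (max 0 t) \<xi>) \<in> borel_measurable borel"
    using S_cont' by (rule borel_measurable_continuous_onI)
  have "(\<lambda>p. S (max 0 (fst p)) \<xi> + (\<integral>r. green r
      (if 0 \<le> s (p, r) then exp (- h (p, r)) *\<^sub>R F (exp (h (p, r)) *\<^sub>R f (p, r)) else 0) \<partial>lborel))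
      \<in> borel_measurable (borel \<Otimes>\<^sub>M M)"
    by measurable
  then show ?case
  proof (rule measurable_cong[THEN iffD1, rotated])
    fix p assume p: "p \<in> space (borel \<Otimes>\<^sub>M M :: (real \<times> (real \<Rightarrow> real)) measure)"
    then interpret lyapunov_perron S V P a b K "G_rescaled (snd p)" L
      by (intro lyapunov_perron_rescaled) (auto simp: space_pair_measure space_M)
    have "(if 0 \<le> s (p, r) then exp (- h (p, r)) *\<^sub>R F (exp (h (p, r)) *\<^sub>R f (p, r)) else 0)
        = force (picard \<xi> n) (max 0 (fst p) - r)" for r
      by (simp add: force_def G_rescaled_def total_weight_def weight_def h_def f_def s_def)
    then show "S (max 0 (fst p)) \<xi> + (\<integral>r. green r
      (if 0 \<le> s (p, r) then exp (- h (p, r)) *\<^sub>R F (exp (h (p, r)) *\<^sub>R f (p, r)) else 0) \<partial>lborel)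
      = (case p of (t, \<omega>) \<Rightarrow> iterate \<omega> \<xi> (Suc n) (max 0 t))"
      by (simp add: case_prod_unfold picard_Suc lp_def)
  qed
qed

lemma fibre_measurable:
  assumes "P \<xi> = 0"
  shows "(\<lambda>\<omega>. fibre \<omega> \<xi>) \<in> borel_measurable M"
proof (rule borel_measurable_LIMSEQ_metric)
  fix n
  have "(\<lambda>\<omega>. iterate \<omega> \<xi> n (max 0 0)) \<in> borel_measurable M"
    using measurable_compose[of "\<lambda>\<omega>. (0, \<omega>)" M, OF _ iterate_measurable] by simp
  then show "(\<lambda>\<omega>. P (iterate \<omega> \<xi> n 0)) \<in> borel_measurable M"
    by (intro borel_measurable_continuous_on[of "blinfun_apply P"]) (auto intro!: continuous_intros)
next
  fix \<omega> assume "\<omega> \<in> space M"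
  then interpret lyapunov_perron S V P a b K "G_rescaled \<omega>" L
    by (intro lyapunov_perron_rescaled) (simp add: space_M)
  show "(\<lambda>n. P (iterate \<omega> \<xi> n 0)) \<longlonglongrightarrow> fibre \<omega> \<xi>"
    by (rule stable_fibre_limit[OF assms])
qed

section \<open>Mild solutions and the stable set of the random equation\<close>

text \<open>The weight turns the scalar factors of the mild formulation into 1, by additivity of the
  integrals of the stationary process.\<close>

lemma mild_solution_iff:
  assumes \<omega>: "\<omega> \<in> \<Omega>"
  shows "mild_solution (\<lambda>t. exp (\<eta> * t) *\<^sub>R S t) F \<omega> x v \<longleftrightarrow>
    lyapunov_perron.solution S (G_rescaled \<omega>) x (\<lambda>t. exp (- weight \<omega> t) *\<^sub>R v t)"
proof -
  interpret lyapunov_perron S V P a b K "G_rescaled \<omega>" L by (rule lyapunov_perron_rescaled[OF \<omega>])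
  have "v t = exp (zOU_int \<omega> 0 t) *\<^sub>R (exp (\<eta> * t) *\<^sub>R S t) x +
        (LBINT s:{0..t}. exp (zOU_int \<omega> s t) *\<^sub>R (exp (\<eta> * (t - s)) *\<^sub>R S (t - s)) (G_of F (wiener_shift s \<omega>) (v s)))
    \<longleftrightarrow> exp (- weight \<omega> t) *\<^sub>R v t = S t x + (LBINT s:{0..t}. S (t - s) (G_rescaled \<omega> s (exp (- weight \<omega> s) *\<^sub>R v s)))"
    if t: "0 \<le> t" for t
  proof -
    have "exp (zOU_int \<omega> s t) *\<^sub>R (exp (\<eta> * (t - s)) *\<^sub>R S (t - s)) (G_of F (wiener_shift s \<omega>) (v s))
        = exp (weight \<omega> t) *\<^sub>R S (t - s) (G_rescaled \<omega> s (exp (- weight \<omega> s) *\<^sub>R v s))" for s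
    proof -
      have "zOU_int \<omega> s t + \<eta> * (t - s) = weight \<omega> t - weight \<omega> s"
        using zint_add[OF \<omega>, of 0 s t] by (simp add: weight_def algebra_simps)
      then have "zOU_int \<omega> s t + (- zOU (wiener_shift s \<omega>) + \<eta> * (t - s)) = weight \<omega> t + - total_weight \<omega> s"
        by (simp add: total_weight_def)
      then have outer: "exp (zOU_int \<omega> s t) * (exp (- zOU (wiener_shift s \<omega>)) * exp (\<eta> * (t - s)))
          = exp (weight \<omega> t) * exp (- total_weight \<omega> s)"
        by (simp only: exp_add[symmetric])
      have inner: "exp (total_weight \<omega> s) * exp (- weight \<omega> s) = exp (zOU (wiener_shift s \<omega>))"
        by (simp only: exp_add[symmetric]) (simp add: total_weight_def)
      show ?thesis
        by (simp only: G_of_def G_rescaled_def blinfun.scaleR_left blinfun.scaleR_right scaleR_scaleR inner outer)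
    qed
    then have "(LBINT s:{0..t}. exp (zOU_int \<omega> s t) *\<^sub>R (exp (\<eta> * (t - s)) *\<^sub>R S (t - s)) (G_of F (wiener_shift s \<omega>) (v s)))
      = exp (weight \<omega> t) *\<^sub>R (LBINT s:{0..t}. S (t - s) (G_rescaled \<omega> s (exp (- weight \<omega> s) *\<^sub>R v s)))"
      by simp
    moreover have "exp (zOU_int \<omega> 0 t) *\<^sub>R (exp (\<eta> * t) *\<^sub>R S t) x = exp (weight \<omega> t) *\<^sub>R S t x"
      by (simp add: weight_def exp_add blinfun.scaleR_left mult.commute)
    moreover have "v t = exp (weight \<omega> t) *\<^sub>R y \<longleftrightarrow> exp (- weight \<omega> t) *\<^sub>R v t = y" for y
      by (auto simp: exp_minus)
    ultimately show ?thesis by (simp add: scaleR_add_right[symmetric])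
  qed
  then show ?thesis by (simp add: mild_solution_def solution_def continuous_on_weight_iff[OF \<omega>])
qed

lemma C_eta_plus_iff:
  fixes v :: "real \<Rightarrow> 'h"
  assumes \<omega>: "\<omega> \<in> \<Omega>"
  shows "v \<in> C_eta_plus \<eta> \<omega> \<longleftrightarrow> bounded_path (\<lambda>t. exp (- weight \<omega> t) *\<^sub>R v t)"
proof -
  have "bounded ((\<lambda>t. exp (- weight \<omega> t) *\<^sub>R v t) ` {0..}) \<longleftrightarrow>
      bdd_above ((\<lambda>t. exp (- \<eta> * t - zOU_int \<omega> 0 t) * norm (v t)) ` {0..})"
    by (simp add: bdd_above_norm[symmetric] image_image weight_def)
  then show ?thesis
    by (simp only: C_eta_plus_def bounded_path_def mem_Collect_eq continuous_on_weight_iff[OF \<omega>])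
qed

text \<open>Uniqueness of mild solutions identifies the bounded solution produced by the fixed point with
  the given solution \<open>u\<close>.\<close>

lemma stable_set_eq:
  assumes \<omega>: "\<omega> \<in> \<Omega>"
    and u: "\<And>x. unique_mild_solution (\<lambda>t. exp (\<eta> * t) *\<^sub>R S t) F \<omega> x (\<lambda>t. u t \<omega> x)"
  shows "stable_set u \<eta> \<omega> = {x. x = (x - P x) + fibre \<omega> (x - P x)}"
proof -
  interpret lyapunov_perron S V P a b K "G_rescaled \<omega>" L by (rule lyapunov_perron_rescaled[OF \<omega>])
  have "x \<in> stable_set u \<eta> \<omega> \<longleftrightarrow> (\<exists>f. bounded_path f \<and> solution x f)" for x
  proof
    assume "x \<in> stable_set u \<eta> \<omega>"
    then have "bounded_path (\<lambda>t. exp (- weight \<omega> t) *\<^sub>R u t \<omega> x)"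
      by (simp add: stable_set_def C_eta_plus_iff[OF \<omega>])
    moreover have "solution x (\<lambda>t. exp (- weight \<omega> t) *\<^sub>R u t \<omega> x)"
      using u[of x] by (simp add: unique_mild_solution_def mild_solution_iff[OF \<omega>])
    ultimately show "\<exists>f. bounded_path f \<and> solution x f" by blast
  next
    assume "\<exists>f. bounded_path f \<and> solution x f"
    then obtain f where f: "bounded_path f" "solution x f" by blast
    have [simp]: "exp (- weight \<omega> t) *\<^sub>R exp (weight \<omega> t) *\<^sub>R y = y" for t and y :: 'h
      by (simp add: exp_minus)
    have "mild_solution (\<lambda>t. exp (\<eta> * t) *\<^sub>R S t) F \<omega> x (\<lambda>t. exp (weight \<omega> t) *\<^sub>R f t)"
      using f(2) by (simp only: mild_solution_iff[OF \<omega>]) (simp del: scaleR_scaleR)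
    then have eq: "exp (weight \<omega> t) *\<^sub>R f t = u t \<omega> x" if "0 \<le> t" for t
      using u[of x] that unfolding unique_mild_solution_def by blast
    then have eq': "f t = exp (- weight \<omega> t) *\<^sub>R u t \<omega> x" if "0 \<le> t" for t
      using eq[OF that, symmetric] by (simp del: scaleR_scaleR)
    have "bounded_path (\<lambda>t. exp (- weight \<omega> t) *\<^sub>R u t \<omega> x)"
      by (rule bounded_path_cong[OF eq' f(1)])
    then show "x \<in> stable_set u \<eta> \<omega>"
      by (simp add: stable_set_def C_eta_plus_iff[OF \<omega>])
  qed
  then show ?thesis by (auto simp: bounded_solution_iff)
qed

lemma weight_shift:
  assumes "\<omega> \<in> \<Omega>" "0 \<le> s"
  shows "weight (wiener_shift t \<omega>) s = weight \<omega> (t + s) - weight \<omega> t"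
  using zint_add[OF assms(1), of 0 t "t + s"] assms(2)
  by (simp add: weight_def zint_shift algebra_simps)

text \<open>By the cocycle property the solution started at time \<open>t\<close> is a tail of the old one, and the two
  weights differ by the factor \<open>exp (weight \<omega> t)\<close>, which is constant along the tail.\<close>

lemma stable_set_invariant:
  fixes u :: "real \<Rightarrow> (real \<Rightarrow> real) \<Rightarrow> 'h \<Rightarrow> 'h"
  assumes \<omega>: "\<omega> \<in> \<Omega>" and t: "0 \<le> t" and u: "random_dynamical_system M u" and x: "x \<in> stable_set u \<eta> \<omega>"
  shows "u t \<omega> x \<in> stable_set u \<eta> (wiener_shift t \<omega>)"
proof -
  let ?f = "\<lambda>s. exp (- weight \<omega> s) *\<^sub>R u s \<omega> x"
  have f: "bounded_path ?f" using x by (simp add: stable_set_def C_eta_plus_iff[OF \<omega>])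
  then have fc: "continuous_on {0..} ?f" and fb: "bounded (?f ` {0..})"
    by (simp_all add: bounded_path_def)
  have "continuous_on {0..} (\<lambda>s. ?f (t + s))"
    by (rule continuous_on_compose2[OF fc]) (use t in \<open>auto intro!: continuous_intros\<close>)
  moreover have "bounded ((\<lambda>s. ?f (t + s)) ` {0..})"
    by (rule bounded_subset[OF fb]) (use t in force)
  ultimately have scaled: "bounded_path (\<lambda>s. exp (weight \<omega> t) *\<^sub>R ?f (t + s))"
    unfolding bounded_path_def
    using bounded_scaling[of "(\<lambda>s. ?f (t + s)) ` {0..}" "exp (weight \<omega> t)"]
    by (simp only: image_image) (simp only: continuous_on_scaleR[OF continuous_on_const])
  have "exp (weight \<omega> t) *\<^sub>R ?f (t + s) =
      exp (- weight (wiener_shift t \<omega>) s) *\<^sub>R u s (wiener_shift t \<omega>) (u t \<omega> x)" if "0 \<le> s" for s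
    using u \<omega> t that
    by (simp add: random_dynamical_system_def space_M weight_shift exp_add[symmetric])
  from bounded_path_cong[OF this scaled]
  have "bounded_path (\<lambda>s. exp (- weight (wiener_shift t \<omega>) s) *\<^sub>R u s (wiener_shift t \<omega>) (u t \<omega> x))" .
  then show ?thesis
    by (simp add: stable_set_def C_eta_plus_iff shift_in[OF \<omega>])
qed

lemma stable_set_param:
  assumes \<omega>: "\<omega> \<in> \<Omega>"
    and u: "\<And>x. unique_mild_solution (\<lambda>t. exp (\<eta> * t) *\<^sub>R S t) F \<omega> x (\<lambda>t. u t \<omega> x)"
  shows "stable_set u \<eta> \<omega> = {\<xi> + fibre \<omega> \<xi> | \<xi>. P \<xi> = 0}"
proof -
  interpret lyapunov_perron S V P a b K "G_rescaled \<omega>" L by (rule lyapunov_perron_rescaled[OF \<omega>])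
  have "x = (x - P x) + fibre \<omega> (x - P x) \<longleftrightarrow> (\<exists>\<xi>. x = \<xi> + fibre \<omega> \<xi> \<and> P \<xi> = 0)" for x
  proof
    assume "x = (x - P x) + fibre \<omega> (x - P x)"
    moreover have "P (x - P x) = 0" by (simp add: blinfun.diff_right P_idem)
    ultimately show "\<exists>\<xi>. x = \<xi> + fibre \<omega> \<xi> \<and> P \<xi> = 0" by blast
  next
    assume "\<exists>\<xi>. x = \<xi> + fibre \<omega> \<xi> \<and> P \<xi> = 0"
    then obtain \<xi> where \<xi>: "x = \<xi> + fibre \<omega> \<xi>" "P \<xi> = 0" by blast
    have "P (fibre \<omega> \<xi>) = fibre \<omega> \<xi>"
      using stable_fibre_range[OF \<xi>(2)] P_idem by auto
    then have "x - P x = \<xi>" using \<xi> by (simp add: blinfun.add_right)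
    with \<xi> show "x = (x - P x) + fibre \<omega> (x - P x)" by simp
  qed
  then show ?thesis unfolding stable_set_eq[where u = u, OF assms] by blast
qed

lemma fibre_cont: assumes "\<omega> \<in> \<Omega>" shows "continuous_on UNIV (\<lambda>y. fibre \<omega> (y - P y))"
proof -
  interpret lyapunov_perron S V P a b K "G_rescaled \<omega>" L by (rule lyapunov_perron_rescaled[OF assms])
  show ?thesis
    by (rule continuous_on_compose2[OF lipschitz_on_continuous_on[OF stable_fibre_lipschitz]])
       (auto intro!: continuous_intros simp: blinfun.diff_right P_idem)
qed

lemma range_compl_proj: "range (compl_proj P) = {\<xi>. P \<xi> = 0}"
proof -
  have "\<xi> \<in> range (compl_proj P)" if "P \<xi> = 0" for \<xi>
    using that by (intro range_eqI[of _ _ \<xi>]) (simp add: compl_proj_def blinfun.diff_left)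
  moreover have "P (compl_proj P x) = 0" for x
    by (simp add: compl_proj_def blinfun.diff_left blinfun.diff_right P_idem)
  ultimately show ?thesis by blast
qed

text \<open>Multiplication by \<open>exp (zOU \<omega>)\<close> maps the graph of \<open>fibre \<omega>\<close> to the graph of
  \<open>\<xi> \<mapsto> exp (zOU \<omega>) fibre \<omega> (exp (- zOU \<omega>) \<xi>)\<close>, which has the same Lipschitz constant.\<close>

theorem stable_manifold:
  assumes u_mild: "\<And>\<omega> x. \<omega> \<in> \<Omega> \<Longrightarrow>
      unique_mild_solution (\<lambda>t. exp (\<eta> * t) *\<^sub>R S t) F \<omega> x (\<lambda>t. u t \<omega> x)"
    and u_rds: "random_dynamical_system M u"
  shows "lipschitz_stable_manifold M P (spde_rds u) (\<lambda>\<omega>. T_inv \<omega> ` stable_set u \<eta> \<omega>)"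
proof -
  let ?R = "\<lambda>\<omega>. T_inv \<omega> ` stable_set u \<eta> \<omega>"
  define h where "h \<xi> \<omega> = exp (zOU \<omega>) *\<^sub>R fibre \<omega> (exp (- zOU \<omega>) *\<^sub>R \<xi>)" for \<xi> \<omega>
  \<comment> \<open>parametrisation by the whole space, whose dense sequences do not depend on the noise\<close>
  define m where "m \<omega> y = exp (zOU \<omega>) *\<^sub>R ((y - P y) + fibre \<omega> (y - P y))" for \<omega> y
  have ker: "P (y - P y) = 0" for y by (simp add: blinfun.diff_right P_idem)
  have R_eq: "?R \<omega> = {exp (zOU \<omega>) *\<^sub>R (\<xi> + fibre \<omega> \<xi>) | \<xi>. P \<xi> = 0}" if "\<omega> \<in> \<Omega>" for \<omega>
    unfolding stable_set_param[where u = u, OF that u_mild[OF that]] T_inv_def by blast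
  have R_graph: "?R \<omega> = {\<xi> + h \<xi> \<omega> | \<xi>. P \<xi> = 0}" if "\<omega> \<in> \<Omega>" for \<omega>
  proof -
    have "{exp (zOU \<omega>) *\<^sub>R (\<xi> + fibre \<omega> \<xi>) | \<xi>. P \<xi> = 0} = {\<xi> + h \<xi> \<omega> | \<xi>. P \<xi> = 0}"
    proof (intro set_eqI iffI; clarify)
      fix \<xi> assume "P \<xi> = 0"
      then show "\<exists>\<zeta>. exp (zOU \<omega>) *\<^sub>R (\<xi> + fibre \<omega> \<xi>) = \<zeta> + h \<zeta> \<omega> \<and> P \<zeta> = 0"
        by (intro exI[of _ "exp (zOU \<omega>) *\<^sub>R \<xi>"])
           (simp add: h_def scaleR_add_right blinfun.scaleR_right exp_minus)
    next
      fix \<xi> assume "P \<xi> = 0"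
      then show "\<exists>\<zeta>. \<xi> + h \<xi> \<omega> = exp (zOU \<omega>) *\<^sub>R (\<zeta> + fibre \<omega> \<zeta>) \<and> P \<zeta> = 0"
        by (intro exI[of _ "exp (- zOU \<omega>) *\<^sub>R \<xi>"])
           (simp add: h_def scaleR_add_right blinfun.scaleR_right exp_minus)
    qed
    then show ?thesis by (simp only: R_eq[OF that])
  qed
  have R_m: "?R \<omega> = range (m \<omega>)" if "\<omega> \<in> \<Omega>" for \<omega>
    unfolding R_eq[OF that]
  proof (intro set_eqI iffI)
    fix x assume "x \<in> {exp (zOU \<omega>) *\<^sub>R (\<xi> + fibre \<omega> \<xi>) | \<xi>. P \<xi> = 0}"
    then obtain \<xi> where "x = exp (zOU \<omega>) *\<^sub>R (\<xi> + fibre \<omega> \<xi>)" "P \<xi> = 0" by blast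
    then have "x = m \<omega> \<xi>" by (simp add: m_def)
    then show "x \<in> range (m \<omega>)" by (rule range_eqI)
  qed (use ker in \<open>auto simp: m_def\<close>)
  have closed: "closed (?R \<omega>)" if \<omega>: "\<omega> \<in> \<Omega>" for \<omega>
  proof -
    have "closed (stable_set u \<eta> \<omega>)"
      unfolding stable_set_eq[where u = u, OF \<omega> u_mild[OF \<omega>]]
      by (intro closed_Collect_eq continuous_intros fibre_cont[OF \<omega>])
    then show ?thesis unfolding T_inv_def by (rule closed_scaling)
  qed
  have m_cont: "continuous_on UNIV (m \<omega>)" if "\<omega> \<in> \<Omega>" for \<omega>
    unfolding m_def by (intro continuous_intros fibre_cont[OF that])
  have m_meas: "(\<lambda>\<omega>. m \<omega> y) \<in> borel_measurable M" for y
    unfolding m_def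
    by (intro borel_measurable_scaleR borel_measurable_add borel_measurable_const fibre_measurable ker
        measurable_compose[OF z_measurable borel_measurable_exp])
  have "(\<lambda>\<omega>. INF y\<in>?R \<omega>. norm (x - y)) \<in> borel_measurable M" for x
  proof (rule measurable_cong[THEN iffD1])
    show "(\<lambda>\<omega>. INF y\<in>range (m \<omega>). norm (x - y)) \<in> borel_measurable M"
      using m_cont m_meas by (intro borel_measurable_dist_parametrized_set) (simp_all only: space_M)
  qed (simp only: R_m space_M)
  moreover have "?R \<omega> \<noteq> {}" if "\<omega> \<in> \<Omega>" for \<omega>
    unfolding R_m[OF that] by simp
  ultimately have random: "random_set M ?R"
    unfolding random_set_def space_M using closed by blast
  have invariant: "spde_rds u t \<omega> ` ?R \<omega> \<subseteq> ?R (wiener_shift t \<omega>)" if "0 \<le> t" "\<omega> \<in> \<Omega>" for t \<omega>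
  proof (clarify)
    fix x assume "x \<in> stable_set u \<eta> \<omega>"
    from stable_set_invariant[OF that(2,1) u_rds this]
    show "spde_rds u t \<omega> (T_inv \<omega> x) \<in> ?R (wiener_shift t \<omega>)"
      by (simp add: spde_rds_def T_map_def T_inv_def exp_minus)
  qed
  have "(\<lambda>\<xi>. h \<xi> \<omega>) \<in> range (compl_proj P) \<rightarrow> range P \<and>
      (\<exists>C. C-lipschitz_on (range (compl_proj P)) (\<lambda>\<xi>. h \<xi> \<omega>))" if \<omega>: "\<omega> \<in> \<Omega>" for \<omega>
  proof -
    interpret lyapunov_perron S V P a b K "G_rescaled \<omega>" L by (rule lyapunov_perron_rescaled[OF \<omega>])
    define C where "C = norm P * K / (1 - contraction_const)"
    have "h \<xi> \<omega> \<in> range P" if "P \<xi> = 0" for \<xi>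
    proof -
      have "P (exp (- zOU \<omega>) *\<^sub>R \<xi>) = 0" using that by (simp add: blinfun.scaleR_right)
      from stable_fibre_range[OF this] obtain y where "fibre \<omega> (exp (- zOU \<omega>) *\<^sub>R \<xi>) = P y" by blast
      then have "h \<xi> \<omega> = P (exp (zOU \<omega>) *\<^sub>R y)" by (simp add: h_def blinfun.scaleR_right)
      then show ?thesis by blast
    qed
    moreover have "C-lipschitz_on {\<xi>. P \<xi> = 0} (\<lambda>\<xi>. h \<xi> \<omega>)"
    proof (rule lipschitz_onI)
      fix \<xi> \<zeta> assume "\<xi> \<in> {\<xi>. P \<xi> = 0}" "\<zeta> \<in> {\<xi>. P \<xi> = 0}"
      then have "dist (fibre \<omega> (exp (- zOU \<omega>) *\<^sub>R \<xi>)) (fibre \<omega> (exp (- zOU \<omega>) *\<^sub>R \<zeta>))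
          \<le> C * dist (exp (- zOU \<omega>) *\<^sub>R \<xi>) (exp (- zOU \<omega>) *\<^sub>R \<zeta>)"
        unfolding C_def by (intro lipschitz_onD[OF stable_fibre_lipschitz]) (simp_all add: blinfun.scaleR_right)
      from mult_left_mono[OF this, of "exp (zOU \<omega>)"]
      have "exp (zOU \<omega>) * dist (fibre \<omega> (exp (- zOU \<omega>) *\<^sub>R \<xi>)) (fibre \<omega> (exp (- zOU \<omega>) *\<^sub>R \<zeta>))
          \<le> exp (zOU \<omega>) * (C * dist (exp (- zOU \<omega>) *\<^sub>R \<xi>) (exp (- zOU \<omega>) *\<^sub>R \<zeta>))"
        by simp
      also have "\<dots> = C * dist \<xi> \<zeta>"
        by (simp add: dist_norm scaleR_diff_right[symmetric] exp_minus)
      finally show "dist (h \<xi> \<omega>) (h \<zeta> \<omega>) \<le> C * dist \<xi> \<zeta>"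
        by (simp only: h_def dist_norm scaleR_diff_right[symmetric] norm_scaleR abs_exp_cancel)
    qed (use K_nonneg contraction_const in \<open>simp add: C_def\<close>)
    ultimately show ?thesis unfolding range_compl_proj by blast
  qed
  then have "\<forall>\<omega>\<in>\<Omega>. (\<lambda>\<xi>. h \<xi> \<omega>) \<in> range (compl_proj P) \<rightarrow> range P \<and>
      (\<exists>C. C-lipschitz_on (range (compl_proj P)) (\<lambda>\<xi>. h \<xi> \<omega>)) \<and>
      ?R \<omega> = {\<xi> + h \<xi> \<omega> | \<xi>. \<xi> \<in> range (compl_proj P)}"
    unfolding range_compl_proj mem_Collect_eq
    by (intro ballI conjI R_graph) blast+
  moreover have "invariant_random_set M (spde_rds u) ?R"
    unfolding invariant_random_set_def space_M using random invariant by blast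
  ultimately show ?thesis
    unfolding lipschitz_stable_manifold_def space_M by (intro conjI exI[of _ h])
qed

end

section \<open>The stable manifold of the stochastic equation\<close>

theorem theorem3p2:
  fixes A :: "'h::{real_inner,banach,second_countable_topology} \<Rightarrow> 'h"
    and D :: "'h set"
    and S :: "real \<Rightarrow> 'h \<Rightarrow>\<^sub>L 'h"
    and P :: "'h \<Rightarrow>\<^sub>L 'h"
    and F :: "'h \<Rightarrow> 'h"
    and \<alpha> \<beta> \<eta> K LipF LipuG :: real
    and W :: "(real \<Rightarrow> real) measure"
    and \<Omega> :: "(real \<Rightarrow> real) set"
    and u :: "real \<Rightarrow> (real \<Rightarrow> real) \<Rightarrow> 'h \<Rightarrow> 'h"
  assumes infinite_dim: "\<nexists>B :: 'h set. finite B \<and> span B = UNIV"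
    and generator: "generates_C0_semigroup D A S"
    and dichotomy: "exponential_dichotomy S P \<alpha> \<beta> K"
    and F_0: "F 0 = 0"
    and LipF: "0 < LipF" "proj_lipschitz P LipF F"
    and W: "wiener_measure W"
    and \<Omega>: "noise_set W \<Omega>"
    and LipuG: "\<And>\<omega>. \<omega> \<in> \<Omega> \<Longrightarrow> proj_lipschitz P LipuG (G_of F \<omega>)"
    and u_mild: "\<And>\<omega> x. \<omega> \<in> \<Omega> \<Longrightarrow> unique_mild_solution S F \<omega> x (\<lambda>t. u t \<omega> x)"
    and u_rds: "random_dynamical_system (restrict_space W \<Omega>) u"
    and \<eta>: "\<beta> < \<eta>" "\<eta> < \<alpha>"
    and gap: "K * LipuG * (1 / (\<eta> - \<beta>) + 1 / (\<alpha> - \<eta>)) < 1"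
  shows "random_dynamical_system (restrict_space W \<Omega>) (spde_rds u) \<and>
    lipschitz_stable_manifold (restrict_space W \<Omega>) P (spde_rds u)
      (\<lambda>\<omega>. T_inv \<omega> ` stable_set u \<eta> \<omega>)"
proof -
  interpret ou_noise W \<Omega>
  proof
    show "sets W = sets borel_C0" using W unfolding wiener_measure_def by (elim conjE)
  qed (rule \<Omega>)
  obtain x0 :: 'h where x0: "x0 \<noteq> 0"
  proof -
    have "span {} \<noteq> (UNIV :: 'h set)" using infinite_dim by blast
    then show thesis using that by auto
  qed
  \<comment> \<open>the Lipschitz estimate for one \<open>G \<omega>\<close> gives that of its conjugate \<open>F\<close>, with the same constant\<close>
  obtain \<omega>0 where \<omega>0: "\<omega>0 \<in> \<Omega>" using \<Omega>_nonempty by blast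
  have F_lip: "proj_lipschitz P LipuG F"
    unfolding proj_lipschitz_def
  proof (intro allI)
    fix x y
    let ?e = "exp (zOU \<omega>0)" and ?e' = "exp (- zOU \<omega>0)"
    have F: "F z = ?e *\<^sub>R G_of F \<omega>0 (?e' *\<^sub>R z)" for z
      by (simp add: G_of_def exp_minus)
    have d: "F x - F y = ?e *\<^sub>R (G_of F \<omega>0 (?e' *\<^sub>R x) - G_of F \<omega>0 (?e' *\<^sub>R y))"
      by (simp only: F[of x] F[of y] scaleR_diff_right)
    have n: "norm (Q (F x - F y)) \<le> LipuG * norm (x - y)"
      if "norm (Q (G_of F \<omega>0 (?e' *\<^sub>R x) - G_of F \<omega>0 (?e' *\<^sub>R y))) \<le> LipuG * norm (?e' *\<^sub>R x - ?e' *\<^sub>R y)"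
      for Q :: "'h \<Rightarrow>\<^sub>L 'h"
    proof -
      have "norm (Q (F x - F y)) = ?e * norm (Q (G_of F \<omega>0 (?e' *\<^sub>R x) - G_of F \<omega>0 (?e' *\<^sub>R y)))"
        by (simp only: d blinfun.scaleR_right norm_scaleR abs_exp_cancel)
      also have "\<dots> \<le> ?e * (LipuG * norm (?e' *\<^sub>R x - ?e' *\<^sub>R y))"
        using that by (rule mult_left_mono) simp
      also have "\<dots> = LipuG * norm (x - y)"
        by (simp add: scaleR_diff_right[symmetric] exp_minus)
      finally show ?thesis .
    qed
    show "norm (P (F x - F y)) \<le> LipuG * norm (x - y) \<and>
        norm (compl_proj P (F x - F y)) \<le> LipuG * norm (x - y)"
      using LipuG[OF \<omega>0] unfolding proj_lipschitz_def by (intro conjI n) blast+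
  qed
  have "0 \<le> LipuG * norm x0"
  proof (rule order_trans[OF norm_ge_zero])
    show "norm (P (F x0 - F 0)) \<le> LipuG * norm x0"
      using F_lip unfolding proj_lipschitz_def by (metis diff_zero)
  qed
  then have L: "0 \<le> LipuG" using x0 by (simp add: zero_le_mult_iff)
  have "C0_semigroup S" using generator by (simp add: generates_C0_semigroup_def)
  then obtain V where "hyperbolic_semigroup S V P \<alpha> (- \<beta>) K"
    using exponential_dichotomy_hyperbolic[OF _ dichotomy x0] by blast
  from hyperbolic_semigroup_rescale[OF this, of \<eta>]
  interpret hyperbolic_semigroup "\<lambda>t. exp (- \<eta> * t) *\<^sub>R S t" "\<lambda>t. exp (\<eta> * t) *\<^sub>R V t" P "\<alpha> - \<eta>" "- \<beta> + \<eta>" K .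
  interpret noisy_equation W \<Omega> "\<lambda>t. exp (- \<eta> * t) *\<^sub>R S t" "\<lambda>t. exp (\<eta> * t) *\<^sub>R V t" P
      "\<alpha> - \<eta>" "- \<beta> + \<eta>" K F LipuG \<eta>
    by unfold_locales (use F_0 F_lip L gap \<eta> in auto)
  have S_eq: "(\<lambda>t. exp (\<eta> * t) *\<^sub>R exp (- \<eta> * t) *\<^sub>R S t) = S"
    by (simp add: exp_minus)
  have "lipschitz_stable_manifold M P (spde_rds u) (\<lambda>\<omega>. T_inv \<omega> ` stable_set u \<eta> \<omega>)"
  proof (rule stable_manifold[OF _ u_rds])
    fix \<omega> x assume "\<omega> \<in> \<Omega>"
    then show "unique_mild_solution (\<lambda>t. exp (\<eta> * t) *\<^sub>R exp (- \<eta> * t) *\<^sub>R S t) F \<omega> x (\<lambda>t. u t \<omega> x)"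
      unfolding S_eq by (rule u_mild)
  qed
  with random_dynamical_system_spde_rds[OF u_rds] show ?thesis by (rule conjI)
qed

end
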